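(* The Minimum Cycle Cover problem can be solved (deterministically) in $\mathcal{O}(2^n\cdot n^3)$ time on $n$-vertex graphs; moreover a minimum cycle cover can be found within the same running time.
   Context: A cycle cover of a graph $G$ is a set of pairwise vertex-disjoint cycles of $G$ such that every vertex of $G$ lies in exactly one of these cycles, where a single vertex is considered a (trivial) cycle; every nontrivial cycle has at least three vertices. The size of a cycle cover is its number of cycles. In the Minimum Cycle Cover problem, given a simple graph $G$, one must find (the size of) a cycle cover of $G$ of minimum size. *)

theory Defs
  imports
    "HOL-Library.Landau_Symbols"
    "Graph_Theory.Pair_Digraph"
    "Graph_Theory.Vertex_Walk"
begin

section \<open>Cycle covers\<close>

text \<open>
  Finite simple graphs are the symmetric loop-free digraphs of \<^locale>\<open>pair_graph\<close>.
  A cycle is given by the list of its vertices in cyclic order. A cycle corresponds to several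
  lists (rotations and reversal), but since the lists in a cover are pairwise disjoint, a cover
  contains only one of them, and its cardinality is the number of its cycles.
\<close>

definition trivial_cycle :: "'a pair_pre_digraph \<Rightarrow> 'a list \<Rightarrow> bool" where
  "trivial_cycle G c \<longleftrightarrow> (\<exists>v \<in> pverts G. c = [v])"

definition nontrivial_cycle :: "'a pair_pre_digraph \<Rightarrow> 'a list \<Rightarrow> bool" where
  "nontrivial_cycle G c \<longleftrightarrow>
     length c \<ge> 3 \<and> vpath c (with_proj G) \<and> (last c, hd c) \<in> parcs G"

definition cycle_cover :: "'a pair_pre_digraph \<Rightarrow> 'a list set \<Rightarrow> bool" where
  "cycle_cover G C \<longleftrightarrow>
     (\<forall>c \<in> C. trivial_cycle G c \<or> nontrivial_cycle G c) \<and>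
     pairwise (\<lambda>c d. disjnt (set c) (set d)) C \<and>
     (\<Union>c \<in> C. set c) = pverts G"

definition min_cycle_cover :: "'a pair_pre_digraph \<Rightarrow> 'a list set \<Rightarrow> bool" where
  "min_cycle_cover G C \<longleftrightarrow>
     cycle_cover G C \<and> (\<forall>D. cycle_cover G D \<longrightarrow> card C \<le> card D)"

definition min_cycle_cover_size :: "'a pair_pre_digraph \<Rightarrow> nat" where
  "min_cycle_cover_size G = (LEAST k. \<exists>C. cycle_cover G C \<and> card C = k)"

section \<open>A deterministic word RAM\<close>

text \<open>
  The machine has registers and a random access memory, both holding words of \<open>w\<close> bits, and is
  programmed in a structured language. Every node of an evaluated expression and every executed
  command or loop test costs one unit of time. All computed values are reduced modulo \<open>2 ^ w\<close>;
  subtraction is truncated at 0, and \<^const>\<open>divide\<close> and \<^const>\<open>modulo\<close> are total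
  (\<open>x div 0 = 0\<close>, \<open>x mod 0 = x\<close>).
\<close>

datatype binop = Add | Sub | Mul | Div | Mod | Less | Equal

datatype expr =
    Const nat
  | Reg nat
  | Load expr
  | Binop binop expr expr

datatype com =
    Skip
  | Assign nat expr
  | Store expr expr
  | Seq com com
  | If expr com com
  | While expr com

text \<open>Register contents and memory contents.\<close>

type_synonym state = "(nat \<Rightarrow> nat) \<times> (nat \<Rightarrow> nat)"

fun apply_binop :: "binop \<Rightarrow> nat \<Rightarrow> nat \<Rightarrow> nat" where
  "apply_binop Add x y = x + y"
| "apply_binop Sub x y = x - y"
| "apply_binop Mul x y = x * y"
| "apply_binop Div x y = x div y"
| "apply_binop Mod x y = x mod y"
| "apply_binop Less x y = (if x < y then 1 else 0)"
| "apply_binop Equal x y = (if x = y then 1 else 0)"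

fun eval_expr :: "nat \<Rightarrow> expr \<Rightarrow> state \<Rightarrow> nat" where
  "eval_expr w (Const k) s = k mod 2 ^ w"
| "eval_expr w (Reg i) s = fst s i"
| "eval_expr w (Load a) s = snd s (eval_expr w a s)"
| "eval_expr w (Binop f a b) s = apply_binop f (eval_expr w a s) (eval_expr w b s) mod 2 ^ w"

fun expr_cost :: "expr \<Rightarrow> nat" where
  "expr_cost (Const k) = 1"
| "expr_cost (Reg i) = 1"
| "expr_cost (Load a) = 1 + expr_cost a"
| "expr_cost (Binop f a b) = 1 + expr_cost a + expr_cost b"

text \<open>\<open>exec w p s t s'\<close>: with word length \<open>w\<close>, program \<open>p\<close> started in state \<open>s\<close>
  halts in state \<open>s'\<close> after exactly \<open>t\<close> units of time.\<close>

inductive exec :: "nat \<Rightarrow> com \<Rightarrow> state \<Rightarrow> nat \<Rightarrow> state \<Rightarrow> bool" for w :: nat where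
  Skip: "exec w Skip s 1 s"
| Assign: "exec w (Assign i a) s (1 + expr_cost a) ((fst s)(i := eval_expr w a s), snd s)"
| Store: "exec w (Store a b) s (1 + expr_cost a + expr_cost b)
            (fst s, (snd s)(eval_expr w a s := eval_expr w b s))"
| Seq: "exec w p s t s' \<Longrightarrow> exec w q s' t' s'' \<Longrightarrow> exec w (Seq p q) s (1 + t + t') s''"
| IfTrue: "eval_expr w b s \<noteq> 0 \<Longrightarrow> exec w p s t s' \<Longrightarrow>
             exec w (If b p q) s (1 + expr_cost b + t) s'"
| IfFalse: "eval_expr w b s = 0 \<Longrightarrow> exec w q s t s' \<Longrightarrow>
              exec w (If b p q) s (1 + expr_cost b + t) s'"
| WhileFalse: "eval_expr w b s = 0 \<Longrightarrow> exec w (While b p) s (1 + expr_cost b) s"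
| WhileTrue: "eval_expr w b s \<noteq> 0 \<Longrightarrow> exec w p s t s' \<Longrightarrow> exec w (While b p) s' t' s'' \<Longrightarrow>
                exec w (While b p) s (1 + expr_cost b + t + t') s''"

inductive_cases exec_SkipE: "exec w Skip s t s'"
inductive_cases exec_AssignE: "exec w (Assign i a) s t s'"
inductive_cases exec_StoreE: "exec w (Store a b) s t s'"
inductive_cases exec_SeqE: "exec w (Seq p q) s t s'"
inductive_cases exec_IfE: "exec w (If b p q) s t s'"
inductive_cases exec_WhileE: "exec w (While b p) s t s'"

lemma exec_deterministic:
  "exec w p s t s' \<Longrightarrow> exec w p s u s'' \<Longrightarrow> t = u \<and> s' = s''"
proof (induction arbitrary: u s'' rule: exec.induct)
  case (Skip s)
  then show ?case by (auto elim: exec_SkipE)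
next
  case (Assign i a s)
  then show ?case by (auto elim: exec_AssignE)
next
  case (Store a b s)
  then show ?case by (auto elim: exec_StoreE)
next
  case (Seq p s t s' q t' s2)
  from Seq.prems obtain t1 s1 t2 where u: "u = Suc (t1 + t2)"
    and p: "exec w p s t1 s1" and q: "exec w q s1 t2 s''"
    by (blast elim: exec_SeqE)
  from Seq.IH(1)[OF p] have "t = t1" "s' = s1" by simp_all
  with Seq.IH(2) q u show ?case by simp
next
  case (IfTrue b s p t s' q)
  from IfTrue.prems show ?case by (rule exec_IfE) (auto simp: IfTrue.hyps dest!: IfTrue.IH)
next
  case (IfFalse b s q t s' p)
  from IfFalse.prems show ?case by (rule exec_IfE) (auto simp: IfFalse.hyps dest!: IfFalse.IH)
next
  case (WhileFalse b s p)
  from WhileFalse.prems show ?case by (rule exec_WhileE) (auto simp: WhileFalse.hyps)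
next
  case (WhileTrue b s p t s' t' s2)
  from WhileTrue.prems WhileTrue.hyps(1) obtain t1 s1 t2
    where u: "u = Suc (expr_cost b + t1 + t2)"
    and p: "exec w p s t1 s1" and q: "exec w (While b p) s1 t2 s''"
    by (auto elim: exec_WhileE)
  from WhileTrue.IH(1)[OF p] have "t = t1" "s' = s1" by simp_all
  with WhileTrue.IH(2) q u show ?case by simp
qed

section \<open>Graph problems and running time\<close>

text \<open>
  A graph on the vertices \<open>{..<n}\<close> is input as \<open>n\<close> in register 0 and its adjacency matrix, row by
  row, in the memory cells \<open>0, \<dots>, n\<^sup>2 - 1\<close>; everything else is 0.
\<close>

definition input_state :: "nat \<Rightarrow> nat pair_pre_digraph \<Rightarrow> state" where
  "input_state n G =
     ((\<lambda>i. if i = 0 then n else 0),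
      (\<lambda>a. if a < n * n \<and> (a div n, a mod n) \<in> parcs G then 1 else 0))"

text \<open>
  The second argument of \<open>correct\<close> is the final state of the machine, from which the output is
  read. The single program \<open>p\<close> must work for all \<open>n\<close>; on graphs with \<open>n\<close> vertices the words need
  only have \<open>c * (n + 1)\<close> bits, as is usual for algorithms using a table of exponential size.
\<close>

definition solvable_in_time ::
    "(nat pair_pre_digraph \<Rightarrow> state \<Rightarrow> bool) \<Rightarrow> (nat \<Rightarrow> real) \<Rightarrow> bool" where
  "solvable_in_time correct f \<longleftrightarrow>
     (\<exists>(p :: com) (c :: nat) (T :: nat \<Rightarrow> nat).
        (\<lambda>n. real (T n)) \<in> O(f) \<and>
        (\<forall>n w G. pair_graph G \<and> pverts G = {..<n} \<and> w \<ge> c * (n + 1) \<longrightarrow>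
           (\<exists>t s. exec w p (input_state n G) t s \<and> t \<le> T n \<and> correct G s)))"

definition outputs_min_cycle_cover_size :: "nat pair_pre_digraph \<Rightarrow> state \<Rightarrow> bool" where
  "outputs_min_cycle_cover_size G s \<longleftrightarrow> fst s 0 = min_cycle_cover_size G"

text \<open>A list of cycles is output as the number of cycles followed, for each cycle, by its length
  and its vertices. Register 0 holds the address of the first word of the output.\<close>

definition encode_cycles :: "nat list list \<Rightarrow> nat list" where
  "encode_cycles cs = length cs # concat (map (\<lambda>c. length c # c) cs)"

definition outputs_min_cycle_cover :: "nat pair_pre_digraph \<Rightarrow> state \<Rightarrow> bool" where
  "outputs_min_cycle_cover G s \<longleftrightarrow>
     (\<exists>cs. distinct cs \<and> min_cycle_cover G (set cs) \<and>
        (\<forall>i < length (encode_cycles cs). snd s (fst s 0 + i) = encode_cycles cs ! i))"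

end

theory Submission
  imports Defs "HOL-Real_Asymp.Real_Asymp"
begin

text \<open>
  A cycle cover is built vertex by vertex. A partial cover is described by a state \<open>(R, s, v)\<close>:
  \<open>R\<close> is the bit mask of the vertices not yet covered, \<open>s\<close> and \<open>v\<close> are the two ends of the path
  that is going to be closed to a cycle next, and \<open>s = n\<close> signals that no path is open. The least
  number of cycles still to be started from a state is determined by the states with smaller
  masks. There are \<open>O(2 ^ n * n\<^sup>2)\<close> states with \<open>O(n)\<close> moves each, whence the running time;
  storing an optimal move with every state allows an optimal cover to be read off the table.

  Each move covers exactly one vertex. In order that a cycle is never closed after two vertices,
  the last vertex of a cycle is added by the same move that closes the cycle, and this move
  requires the path to have two distinct ends already.
\<close>

section \<open>Optimal completions of partial cycle covers\<close>

lemma bit_imp_exp_le: "bit (R :: nat) u \<Longrightarrow> 2 ^ u \<le> R"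
  by (metis bit_iff_odd div_less even_zero leI)

text \<open>The machine has no bit operations, so a vertex is removed by subtraction. No borrow
  occurs, since \<open>R\<close> is \<open>unset_bit u R + 2 ^ u\<close>.\<close>

lemma bit_minus_exp_iff:
  assumes "bit (R :: nat) u"
  shows "bit (R - 2 ^ u) i \<longleftrightarrow> bit R i \<and> i \<noteq> u"
proof -
  have "set_bit u (unset_bit u R) = R"
    using assms by (auto intro!: bit_eqI simp: bit_simps)
  moreover have "set_bit u (unset_bit u R) = unset_bit u R + 2 ^ u"
    by (simp add: set_bit_eq bit_simps)
  ultimately have "R - 2 ^ u = unset_bit u R" by simp
  then show ?thesis by (auto simp: bit_unset_bit_iff)
qed

definition bits :: "nat \<Rightarrow> nat set" where
  "bits R = {u. bit R u}"

lemma bits_minus_exp: "bit R u \<Longrightarrow> bits (R - 2 ^ u) = bits R - {u}"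
  by (auto simp: bits_def bit_minus_exp_iff)

lemma bits_eq_empty_iff: "bits R = {} \<longleftrightarrow> R = 0"
  by (auto simp: bits_def intro: bit_eqI)

lemma bits_mask: "bits (2 ^ n - 1) = {..<n}"
  unfolding bits_def mask_eq_exp_minus_1[symmetric] by (auto simp: bit_simps)

section \<open>The recurrence for the optimal cost\<close>

locale cover_dp = pair_graph G for G :: "nat pair_pre_digraph" +
  fixes n :: nat
  assumes verts: "pverts G = {..<n}"
begin

text \<open>
  The move \<open>m = 2 * u + b\<close> adds the vertex \<open>u\<close>: if no path is open, as a trivial cycle (\<open>b = 0\<close>) or
  as the start of a new path (\<open>b = 1\<close>); otherwise it extends the open path (\<open>b = 0\<close>) and, if
  \<open>b = 1\<close>, also closes it.
\<close>

definition legal :: "nat \<Rightarrow> nat \<Rightarrow> nat \<Rightarrow> nat \<Rightarrow> bool" where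
  "legal R s v m \<longleftrightarrow> m div 2 < n \<and> bit R (m div 2) \<and> (s = n \<or> (v, m div 2) \<in> parcs G) \<and>
     (odd m \<longrightarrow> s = n \<or> ((m div 2, s) \<in> parcs G \<and> s \<noteq> v))"

definition target :: "nat \<Rightarrow> nat \<Rightarrow> nat" where
  "target s m = (if even m then s else if s = n then m div 2 else n)"

text \<open>Legal moves are below \<open>2 * n\<close>, hence remainders modulo this number, which
  is positive even for \<open>n = 0\<close>.\<close>

definition radix :: nat where
  "radix = 2 * (n + 1)"

lemma radix_pos [simp]: "0 < radix"
  by (simp add: radix_def)

text \<open>
  A single number combines the cost of an optimal completion (quotient by the radix) with its first
  move (remainder), so that minimising it yields both. Cost \<open>n + 1\<close> stands for infinity; the cost
  never exceeds \<open>n\<close> as long as no path is open, since trivial cycles are always available.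
\<close>

function best :: "nat \<Rightarrow> nat \<Rightarrow> nat \<Rightarrow> nat" where
  "best R s v =
     Min (insert (if R = 0 \<and> s = n then 0 else (n + 1) * radix)
       ((\<lambda>m. (of_bool (s = n) + best (R - 2 ^ (m div 2)) (target s m) (m div 2) div radix)
                * radix + m) ` {m. legal R s v m}))"
  by pat_completeness auto
termination
proof (relation "measure fst", goal_cases)
  case (2 R s v m)
  then have "2 ^ (m div 2) \<le> R" by (auto simp: legal_def intro: bit_imp_exp_le)
  moreover have "0 < (2 :: nat) ^ (m div 2)" by simp
  ultimately show ?case unfolding in_measure fst_conv by linarith
qed simp

declare best.simps [simp del]

definition cost :: "nat \<Rightarrow> nat \<Rightarrow> nat \<Rightarrow> nat" where
  "cost R s v = best R s v div radix"

definition init :: "nat \<Rightarrow> nat \<Rightarrow> nat" where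
  "init R s = (if R = 0 \<and> s = n then 0 else (n + 1) * radix)"

definition cand :: "nat \<Rightarrow> nat \<Rightarrow> nat \<Rightarrow> nat" where
  "cand R s m = (of_bool (s = n) + cost (R - 2 ^ (m div 2)) (target s m) (m div 2)) * radix + m"

lemma best_eq: "best R s v = Min (insert (init R s) (cand R s ` {m. legal R s v m}))"
  by (subst best.simps) (simp add: init_def cand_def[abs_def] cost_def)

lemma legal_less: "legal R s v m \<Longrightarrow> m < 2 * n"
  by (auto simp: legal_def)

lemma finite_legal: "finite {m. legal R s v m}"
  by (rule finite_subset[of _ "{..<2 * n}"]) (auto dest: legal_less)

lemma best_le_init: "best R s v \<le> init R s"
  unfolding best_eq by (rule Min_le) (auto simp: finite_legal)

lemma best_le: "best R s v \<le> (n + 1) * radix"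
  using best_le_init[of R s v] by (auto simp: init_def split: if_splits)

lemma legal_less_radix: "legal R s v m \<Longrightarrow> m < radix"
  by (auto simp: radix_def dest: legal_less)

lemma cand_div: "m < radix \<Longrightarrow>
    cand R s m div radix = of_bool (s = n) + cost (R - 2 ^ (m div 2)) (target s m) (m div 2)"
  by (simp add: cand_def del: split_of_bool)

lemma cand_mod: "m < radix \<Longrightarrow> cand R s m mod radix = m"
  by (simp add: cand_def)

text \<open>\<open>best\<close> minimises over the combined numbers, and division by the radix is
  monotone, so the minimum transfers to the costs.\<close>

lemma cost_step:
  assumes "legal R s v m"
  shows "cost R s v \<le> of_bool (s = n) + cost (R - 2 ^ (m div 2)) (target s m) (m div 2)"
proof -
  have "best R s v \<le> cand R s m"
    unfolding best_eq using assms by (intro Min_le) (auto simp: finite_legal)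
  then have "cost R s v \<le> cand R s m div radix"
    unfolding cost_def by (rule div_le_mono)
  then show ?thesis using legal_less_radix[OF assms] by (metis cand_div)
qed

text \<open>A finite cost on a nonempty mask rules out the default \<open>init R s\<close>, so the
  minimum is attained by a candidate, and its remainder is the move itself. This allows a solution
  to be traced back.\<close>

lemma best_step:
  assumes "cost R s v \<le> n" "R \<noteq> 0"
  obtains m where "legal R s v m" "best R s v mod radix = m"
    "cost R s v = of_bool (s = n) + cost (R - 2 ^ (m div 2)) (target s m) (m div 2)"
proof -
  have "best R s v \<in> insert (init R s) (cand R s ` {m. legal R s v m})"
    unfolding best_eq by (rule Min_in) (auto simp: finite_legal)
  moreover have "best R s v \<noteq> init R s"
  proof
    assume "best R s v = init R s"
    then have "cost R s v = n + 1" using \<open>R \<noteq> 0\<close> by (simp add: cost_def init_def)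
    then show False using assms(1) by simp
  qed
  ultimately obtain m where m: "legal R s v m" "best R s v = cand R s m" by auto
  show ?thesis
  proof (rule that[of m])
    show "legal R s v m" by fact
    show "best R s v mod radix = m"
      using m legal_less_radix by (metis cand_mod)
    show "cost R s v = of_bool (s = n) + cost (R - 2 ^ (m div 2)) (target s m) (m div 2)"
      using m legal_less_radix by (metis cand_div cost_def)
  qed
qed

text \<open>With no vertex left there is no legal move, so a path still open has infinite cost
  \<open>n + 1\<close>.\<close>

lemma cost_finished:
  assumes "cost 0 s v \<le> n"
  shows "s = n" "cost 0 s v = 0"
proof -
  have "\<not> legal 0 s v m" for m by (simp add: legal_def)
  then have "best 0 s v = init 0 s" by (simp add: best_eq)
  then have *: "cost 0 s v = (if s = n then 0 else n + 1)"
    by (simp add: cost_def init_def)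
  then show "s = n" using assms by (auto split: if_splits)
  with * show "cost 0 s v = 0" by simp
qed

lemma cost_zero: "cost 0 n v = 0"
  using best_le_init[of 0 n v] by (simp add: cost_def init_def)


section \<open>Soundness: legal moves build cycle covers\<close>

definition is_cycle :: "nat list \<Rightarrow> bool" where
  "is_cycle c \<longleftrightarrow> trivial_cycle G c \<or> nontrivial_cycle G c"

text \<open>An open path is the last list of \<open>cs\<close>; if none is open, \<open>v\<close> is
  merely bounded. Excluding \<open>[]\<close> makes distinctness of \<open>concat cs\<close> imply
  distinctness of \<open>cs\<close>.\<close>

definition partial_cover :: "nat \<Rightarrow> nat \<Rightarrow> nat \<Rightarrow> nat list list \<Rightarrow> bool" where
  "partial_cover R s v cs \<longleftrightarrow> R < 2 ^ n \<and> s \<le> n \<and> v \<le> n \<and>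
     distinct (concat cs) \<and> set (concat cs) = {..<n} - bits R \<and> [] \<notin> set cs \<and>
     (if s = n then \<forall>c \<in> set cs. is_cycle c
      else cs \<noteq> [] \<and> (\<forall>c \<in> set (butlast cs). is_cycle c) \<and>
        vwalk (last cs) (with_proj G) \<and> hd (last cs) = s \<and> last (last cs) = v)"

definition extend :: "nat \<Rightarrow> nat \<Rightarrow> nat list list \<Rightarrow> nat list list" where
  "extend s u cs = (if s = n then cs @ [[u]] else butlast cs @ [last cs @ [u]])"

lemma length_extend: "s = n \<or> cs \<noteq> [] \<Longrightarrow> length (extend s u cs) = length cs + of_bool (s = n)"
  by (auto simp: extend_def)

lemma arcs_ends_G: "arcs_ends (with_proj G) = parcs G"
  by (auto simp: arcs_ends_conv)

lemma vwalk_G_iff: "vwalk p (with_proj G) \<longleftrightarrow> set p \<subseteq> {..<n} \<and> set (vwalk_arcs p) \<subseteq> parcs G \<and> p \<noteq> []"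
  by (simp add: vwalk_def arcs_ends_G verts)

lemma vwalk_snoc:
  "vwalk p (with_proj G) \<Longrightarrow> (last p, u) \<in> parcs G \<Longrightarrow> u < n \<Longrightarrow> vwalk (p @ [u]) (with_proj G)"
  by (auto simp: vwalk_G_iff set_vwalk_arcs_snoc)

lemma partial_cover_start: "partial_cover (2 ^ n - 1) n n []"
  by (simp add: partial_cover_def bits_mask del: One_nat_def)

lemma partial_cover_step:
  assumes pc: "partial_cover R s v cs" and m: "legal R s v m"
  shows "partial_cover (R - 2 ^ (m div 2)) (target s m) (m div 2) (extend s (m div 2) cs)"
proof -
  define u where "u = m div 2"
  have u: "u < n" "bit R u" using m by (auto simp: legal_def u_def)
  have u_new: "u \<notin> set (concat cs)"
    using pc u by (auto simp: partial_cover_def bits_def)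
  have bits: "{..<n} - bits (R - 2 ^ u) = insert u ({..<n} - bits R)"
    using u by (auto simp: bits_minus_exp)
  have R: "R - 2 ^ u < 2 ^ n" using pc by (simp add: partial_cover_def less_imp_diff_less)
  show ?thesis
  proof (cases "s = n")
    case True
    have "is_cycle [u]" using u by (auto simp: is_cycle_def trivial_cycle_def verts)
    moreover have "vwalk [u] (with_proj G)" using u by (simp add: vwalk_G_iff)
    ultimately show ?thesis
      using pc True u u_new bits R
      by (auto simp: partial_cover_def extend_def target_def u_def[symmetric])
  next
    case False
    define p where "p = last cs"
    have cs: "cs = butlast cs @ [p]" "cs \<noteq> []" and p: "vwalk p (with_proj G)" "hd p = s" "last p = v" "p \<noteq> []"
      using pc False by (auto simp: partial_cover_def p_def vwalk_def)
    obtain ds where ds: "cs = ds @ [p]" using cs by blast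
    have arc: "(v, u) \<in> parcs G" using m False by (simp add: legal_def u_def)
    have walk: "vwalk (p @ [u]) (with_proj G)" using vwalk_snoc p arc u by simp
    have closed: "is_cycle (p @ [u])" if "odd m"
    proof -
      have us: "(u, s) \<in> parcs G" "s \<noteq> v" using m False that by (auto simp: legal_def u_def)
      \<comment> \<open>A path with two different ends has at least two vertices, so adding
        \<open>u\<close> gives a cycle with at least three.\<close>
      then have "length p \<ge> 2" using p by (cases p rule: remdups_adj.cases) auto
      then show ?thesis
        using walk us p u_new pc
        by (auto simp: is_cycle_def nontrivial_cycle_def vpath_def ds partial_cover_def)
    qed
    show ?thesis
      using pc False u u_new bits R p walk closed
      by (auto simp: partial_cover_def extend_def target_def u_def[symmetric] ds)
  qed
qed

lemma partial_cover_finished: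
  assumes "partial_cover 0 n v cs"
  shows "distinct cs" "cycle_cover G (set cs)"
proof -
  have "bits 0 = {}" by (simp add: bits_eq_empty_iff)
  then have *: "distinct (concat cs)" "set (concat cs) = {..<n}" "[] \<notin> set cs" "\<forall>c \<in> set cs. is_cycle c"
    using assms by (auto simp: partial_cover_def)
  then show "distinct cs" "cycle_cover G (set cs)"
    by (auto simp: distinct_concat_iff cycle_cover_def is_cycle_def verts pairwise_def disjnt_def)
qed

section \<open>Optimality: the cost is at most the size of any cover\<close>

text \<open>The path is traced by extending moves \<open>2 * u\<close> and one final closing move.
  The last hypothesis makes the closing move legal: a freshly started path has \<open>s = v\<close>,
  but then at least one extending move comes first.\<close>

lemma cost_path:
  assumes "xs \<noteq> []" "distinct xs" "set xs \<subseteq> bits R" "R < 2 ^ n" "vwalk (v # xs) (with_proj G)"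
    "(last xs, s) \<in> parcs G" "s < n" "s \<notin> set xs" "s \<noteq> v \<or> length xs \<ge> 2"
  shows "\<exists>R' < 2 ^ n. bits R' = bits R - set xs \<and> cost R s v \<le> cost R' n (last xs)"
  using assms
proof (induction xs arbitrary: R v)
  case (Cons u ys)
  have u: "u < n" "bit R u" "(v, u) \<in> parcs G" "s \<noteq> u"
    using Cons.prems by (auto simp: vwalk_G_iff bits_def)
  have R: "R - 2 ^ u < 2 ^ n" "bits (R - 2 ^ u) = bits R - {u}"
    using Cons.prems u by (auto simp: less_imp_diff_less bits_minus_exp)
  show ?case
  proof (cases "ys = []")
    case True
    have "legal R s v (2 * u + 1)" using u Cons.prems True by (auto simp: legal_def)
    from cost_step[OF this] show ?thesis
      using Cons.prems R True by (intro exI[of _ "R - 2 ^ u"]) (auto simp: target_def)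
  next
    case False
    have "legal R s v (2 * u)" using u Cons.prems by (auto simp: legal_def)
    from cost_step[OF this] have le: "cost R s v \<le> cost (R - 2 ^ u) s u"
      using Cons.prems by (auto simp: target_def)
    have "\<exists>R' < 2 ^ n. bits R' = bits (R - 2 ^ u) - set ys \<and> cost (R - 2 ^ u) s u \<le> cost R' n (last ys)"
      by (rule Cons.IH) (use Cons.prems False R u in \<open>auto simp: vwalk_G_iff\<close>)
    then show ?thesis using le False R by (auto intro: order_trans)
  qed
qed simp

lemma cost_cycle:
  assumes c: "is_cycle c" "set c \<subseteq> bits R" "R < 2 ^ n"
  shows "\<exists>R' < 2 ^ n. \<exists>v'. bits R' = bits R - set c \<and> cost R n v \<le> 1 + cost R' n v'"
  using c(1) unfolding is_cycle_def
proof
  assume "trivial_cycle G c"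
  then obtain u where u: "c = [u]" "u < n" by (auto simp: trivial_cycle_def verts)
  with c have "bit R u" by (auto simp: bits_def)
  then have "legal R n v (2 * u)" using u by (auto simp: legal_def)
  from cost_step[OF this] show ?thesis
    using u \<open>bit R u\<close> c by (intro exI[of _ "R - 2 ^ u"])
      (auto simp: target_def less_imp_diff_less bits_minus_exp)
next
  assume "nontrivial_cycle G c"
  then have nc: "length c \<ge> 3" "vwalk c (with_proj G)" "distinct c" "(last c, hd c) \<in> parcs G"
    by (auto simp: nontrivial_cycle_def vpath_def)
  then obtain u xs where ux: "c = u # xs" by (cases c) auto
  have u: "u < n" "bit R u" using c nc ux by (auto simp: vwalk_G_iff bits_def)
  have "legal R n v (2 * u + 1)" using u by (auto simp: legal_def)
  from cost_step[OF this] have le: "cost R n v \<le> 1 + cost (R - 2 ^ u) u u"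
    by (simp add: target_def)
  have R: "R - 2 ^ u < 2 ^ n" "bits (R - 2 ^ u) = bits R - {u}"
    using c u by (auto simp: less_imp_diff_less bits_minus_exp)
  \<comment> \<open>Both ends of the path just started are \<open>u\<close>;
    \<open>cost_path\<close> still applies because a cycle of length at least three leaves two
    vertices in \<open>xs\<close>.\<close>
  have "\<exists>R' < 2 ^ n. bits R' = bits (R - 2 ^ u) - set xs \<and> cost (R - 2 ^ u) u u \<le> cost R' n (last xs)"
    by (rule cost_path) (use nc ux u R c in \<open>auto split: if_splits\<close>)
  then obtain R' where R': "R' < 2 ^ n" "bits R' = bits (R - 2 ^ u) - set xs"
    "cost (R - 2 ^ u) u u \<le> cost R' n (last xs)" by blast
  show ?thesis
  proof (intro exI conjI)
    show "bits R' = bits R - set c" using R' R ux by auto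
    show "cost R n v \<le> 1 + cost R' n (last xs)" using R' le by simp
  qed (rule R')
qed

text \<open>The cycles are removed one at a time. The induction must generalise \<open>v\<close>,
  since each removed cycle leaves a different last vertex behind.\<close>

lemma cost_le_card:
  assumes "finite C" "\<forall>c \<in> C. is_cycle c" "pairwise (\<lambda>c d. disjnt (set c) (set d)) C"
    "(\<Union>c \<in> C. set c) = bits R" "R < 2 ^ n"
  shows "cost R n v \<le> card C"
  using assms
proof (induction C arbitrary: R v rule: finite_induct)
  case empty
  then have "R = 0" by (simp add: bits_eq_empty_iff[symmetric])
  then show ?case by (simp add: cost_zero)
next
  case (insert c C)
  have "\<exists>R' < 2 ^ n. \<exists>v'. bits R' = bits R - set c \<and> cost R n v \<le> 1 + cost R' n v'"
    by (rule cost_cycle) (use insert.prems in auto)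
  then obtain R' v' where R': "R' < 2 ^ n" "bits R' = bits R - set c"
    "cost R n v \<le> 1 + cost R' n v'" by blast
  have "set c \<inter> set d = {}" if "d \<in> C" for d
    using insert.prems(2) insert.hyps that by (auto simp: pairwise_insert disjnt_def)
  then have "cost R' n v' \<le> card C"
    using insert.prems R' by (intro insert.IH) (auto simp: pairwise_insert)
  then show ?case using R' insert.hyps by simp
qed

text \<open>All cycles are vertex paths of a finite graph. Finiteness matters because
  \<open>card\<close> is 0 on infinite sets.\<close>

lemma cycle_cover_finite:
  assumes "cycle_cover G C"
  shows "finite C"
proof (rule finite_subset)
  show "C \<subseteq> {p. vpath p (with_proj G)}"
    using assms by (auto simp: cycle_cover_def trivial_cycle_def nontrivial_cycle_def vpath_def vwalk_G_iff verts)
  show "finite {p. vpath p (with_proj G)}" by (rule vpaths_finite)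
qed

lemma cost_start_le:
  assumes "cycle_cover G C"
  shows "cost (2 ^ n - 1) n v \<le> card C"
proof (rule cost_le_card)
  show "finite C" using assms by (rule cycle_cover_finite)
  show "(\<Union>c \<in> C. set c) = bits (2 ^ n - 1)"
    using assms by (simp add: cycle_cover_def bits_mask verts del: One_nat_def)
qed (use assms in \<open>auto simp: cycle_cover_def is_cycle_def\<close>)

text \<open>The cover by trivial cycles shows that the initial cost is not the infinite value
  \<open>n + 1\<close>.\<close>

lemma cost_start_le_n: "cost (2 ^ n - 1) n v \<le> n"
proof -
  have "cycle_cover G ((\<lambda>v. [v]) ` {..<n})"
    by (auto simp: cycle_cover_def trivial_cycle_def verts pairwise_def)
  from cost_start_le[OF this, of v] show ?thesis
    by (simp add: card_image inj_on_def)
qed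

lemma partial_cover_optimal:
  assumes "partial_cover 0 n v cs" "length cs = cost (2 ^ n - 1) n n"
  shows "distinct cs" "min_cycle_cover G (set cs)"
  using partial_cover_finished[OF assms(1)] assms(2) cost_start_le[of _ n]
  by (auto simp: min_cycle_cover_def distinct_card)

end

section \<open>Total correctness with running time\<close>

text \<open>
  Overflow is separated from functional correctness: expressions are evaluated over the natural
  numbers, under the side condition that all intermediate values are below a bound \<open>B \<le> 2 ^ w\<close>.
\<close>

fun ideal_eval :: "expr \<Rightarrow> state \<Rightarrow> nat" where
  "ideal_eval (Const k) s = k"
| "ideal_eval (Reg i) s = fst s i"
| "ideal_eval (Load a) s = snd s (ideal_eval a s)"
| "ideal_eval (Binop f a b) s = apply_binop f (ideal_eval a s) (ideal_eval b s)"

text \<open>Truncated subtraction, quotient and remainder never exceed their first operand, so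
  bounding that operand suffices. \<open>Reg\<close> and \<open>Load\<close> need no bound, as the
  machine does not reduce the words it reads.\<close>

fun fits :: "nat \<Rightarrow> expr \<Rightarrow> state \<Rightarrow> bool" where
  "fits B (Const k) s \<longleftrightarrow> k < B"
| "fits B (Reg i) s \<longleftrightarrow> True"
| "fits B (Load a) s \<longleftrightarrow> fits B a s"
| "fits B (Binop f a b) s \<longleftrightarrow> fits B a s \<and> fits B b s \<and>
     (case f of
        Add \<Rightarrow> ideal_eval a s + ideal_eval b s < B
      | Mul \<Rightarrow> ideal_eval a s * ideal_eval b s < B
      | Less \<Rightarrow> True
      | Equal \<Rightarrow> True
      | _ \<Rightarrow> ideal_eval a s < B)"

lemma eval_expr_eq_ideal:
  assumes "fits B e s" "1 < B" "B \<le> 2 ^ w"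
  shows "eval_expr w e s = ideal_eval e s"
  using assms(1)
proof (induction e)
  case (Binop f a b)
  have "apply_binop f (ideal_eval a s) (ideal_eval b s) < B"
    using Binop.prems \<open>1 < B\<close>
    by (cases f) (auto intro: le_less_trans[OF diff_le_self] le_less_trans[OF div_le_dividend]
        le_less_trans[OF mod_less_eq_dividend])
  then show ?case using Binop assms(3) by simp
qed (use assms(3) in auto)

text \<open>Here \<open>B\<close> bounds the running time, whereas in \<open>fits\<close> and
  \<open>wp\<close> it bounds values.\<close>

definition runs :: "nat \<Rightarrow> nat \<Rightarrow> com \<Rightarrow> state \<Rightarrow> (state \<Rightarrow> bool) \<Rightarrow> bool" where
  "runs w B p s Q \<longleftrightarrow> (\<exists>t s'. exec w p s t s' \<and> t \<le> B \<and> Q s')"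

text \<open>A crude bound for loop-free programs, adding both branches of \<open>If\<close>. The
  value for \<open>While\<close> is arbitrary, since \<open>wp\<close> is false there and loops are
  left to \<open>runs_While\<close>.\<close>

fun com_cost :: "com \<Rightarrow> nat" where
  "com_cost Skip = 1"
| "com_cost (Assign i a) = 1 + expr_cost a"
| "com_cost (Store a b) = 1 + expr_cost a + expr_cost b"
| "com_cost (Seq p q) = 1 + com_cost p + com_cost q"
| "com_cost (If b p q) = 1 + expr_cost b + com_cost p + com_cost q"
| "com_cost (While b p) = 0"

fun wp :: "nat \<Rightarrow> com \<Rightarrow> (state \<Rightarrow> bool) \<Rightarrow> state \<Rightarrow> bool" where
  "wp B Skip Q s \<longleftrightarrow> Q s"
| "wp B (Assign i a) Q s \<longleftrightarrow> fits B a s \<and> Q ((fst s)(i := ideal_eval a s), snd s)"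
| "wp B (Store a b) Q s \<longleftrightarrow> fits B a s \<and> fits B b s \<and>
     Q (fst s, (snd s)(ideal_eval a s := ideal_eval b s))"
| "wp B (Seq p q) Q s \<longleftrightarrow> wp B p (wp B q Q) s"
| "wp B (If b p q) Q s \<longleftrightarrow> fits B b s \<and> (if ideal_eval b s \<noteq> 0 then wp B p Q s else wp B q Q s)"
| "wp B (While b p) Q s \<longleftrightarrow> False"

lemma runsI: "exec w p s t s' \<Longrightarrow> t \<le> T \<Longrightarrow> Q s' \<Longrightarrow> runs w T p s Q"
  unfolding runs_def by blast

lemma runsE:
  assumes "runs w T p s Q"
  obtains t s' where "exec w p s t s'" "t \<le> T" "Q s'"
  using assms by (auto simp: runs_def)

lemma runs_Seq:
  assumes "runs w T p s Q" "\<And>s. Q s \<Longrightarrow> runs w T' q s Q'"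
  shows "runs w (1 + T + T') (Seq p q) s Q'"
proof -
  obtain t s' where p: "exec w p s t s'" "t \<le> T" "Q s'" using assms(1) by (rule runsE)
  obtain t' s'' where q: "exec w q s' t' s''" "t' \<le> T'" "Q' s''"
    using assms(2)[OF p(3)] by (rule runsE)
  show ?thesis by (rule runsI[OF exec.Seq[OF p(1) q(1)]]) (use p q in auto)
qed

lemma runs_wp:
  assumes "wp B p Q s" "1 < B" "B \<le> 2 ^ w"
  shows "runs w (com_cost p) p s Q"
  using assms(1)
proof (induction p arbitrary: Q s)
  case Skip
  then show ?case by (intro runsI[OF exec.Skip]) auto
next
  case (Assign i a)
  then show ?case
    by (intro runsI[OF exec.Assign]) (auto simp: eval_expr_eq_ideal[OF _ assms(2,3)])
next
  case (Store a b)
  then show ?case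
    by (intro runsI[OF exec.Store]) (auto simp: eval_expr_eq_ideal[OF _ assms(2,3)])
next
  case (Seq p q)
  have "runs w (com_cost p) p s (wp B q Q)" using Seq by auto
  from runs_Seq[OF this Seq.IH(2)] show ?case by simp
next
  case (If b p q)
  then have b: "eval_expr w b s = ideal_eval b s" by (simp add: eval_expr_eq_ideal[OF _ assms(2,3)])
  show ?case
  proof (cases "ideal_eval b s = 0")
    case True
    then have "runs w (com_cost q) q s Q" using If by simp
    then obtain t s' where "exec w q s t s'" "t \<le> com_cost q" "Q s'" by (rule runsE)
    then show ?thesis using True b by (intro runsI[OF exec.IfFalse]) auto
  next
    case False
    then have "runs w (com_cost p) p s Q" using If by simp
    then obtain t s' where "exec w p s t s'" "t \<le> com_cost p" "Q s'" by (rule runsE)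
    then show ?thesis using False b by (intro runsI[OF exec.IfTrue]) auto
  qed
qed simp

lemma runs_mono:
  "runs w T p s Q \<Longrightarrow> T \<le> T' \<Longrightarrow> (\<And>s. Q s \<Longrightarrow> Q' s) \<Longrightarrow> runs w T' p s Q'"
  unfolding runs_def by (meson le_trans)

text \<open>The invariant is indexed by the number of completed iterations, and the guard holds for
  exactly \<open>m\<close> of them. The final failing test is charged as a full iteration, whence
  the factor \<open>m + 1\<close>.\<close>

lemma runs_While:
  assumes "I 0 s" "1 < B" "B \<le> 2 ^ w"
    and fits: "\<And>k s. k \<le> m \<Longrightarrow> I k s \<Longrightarrow> fits B b s"
    and cond: "\<And>k s. k \<le> m \<Longrightarrow> I k s \<Longrightarrow> ideal_eval b s \<noteq> 0 \<longleftrightarrow> k < m"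
    and step: "\<And>k s. k < m \<Longrightarrow> I k s \<Longrightarrow> runs w T p s (I (Suc k))"
  shows "runs w ((m + 1) * (1 + expr_cost b + T)) (While b p) s (I m)"
proof -
  have b: "eval_expr w b s \<noteq> 0 \<longleftrightarrow> k < m" if "k \<le> m" "I k s" for k s
    using fits[OF that] cond[OF that] by (simp add: eval_expr_eq_ideal[OF _ assms(2,3)])
  have "I k s \<Longrightarrow> k \<le> m \<Longrightarrow> runs w ((m - k + 1) * (1 + expr_cost b + T)) (While b p) s (I m)" for k s
  proof (induction "m - k" arbitrary: k s)
    case 0
    then have "k = m" by simp
    with 0 b[of m s] show ?case by (intro runsI[OF exec.WhileFalse]) auto
  next
    case (Suc j)
    then have k: "k < m" by simp
    from step[OF k \<open>I k s\<close>] obtain t s' where p: "exec w p s t s'" "t \<le> T" "I (Suc k) s'"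
      by (rule runsE)
    have "runs w ((m - Suc k + 1) * (1 + expr_cost b + T)) (While b p) s' (I m)"
      using Suc.hyps p k by (intro Suc.hyps(1)) auto
    then obtain t' s'' where
      q: "exec w (While b p) s' t' s''" "t' \<le> (m - Suc k + 1) * (1 + expr_cost b + T)" "I m s''"
      by (rule runsE)
    have "m - k = Suc (m - Suc k)" using k by simp
    then have "1 + expr_cost b + t + t' \<le> (m - k + 1) * (1 + expr_cost b + T)"
      using p q by (simp add: algebra_simps)
    moreover have "eval_expr w b s \<noteq> 0" using b[of k s] k Suc.prems by simp
    ultimately show ?case using exec.WhileTrue[OF _ p(1) q(1)] q(3) by (intro runsI)
  qed
  from this[of 0 s] show ?thesis using assms(1) by simp
qed

section \<open>The program\<close>

abbreviation plus_expr (infixl "[+]" 65) where "a [+] b \<equiv> Binop Add a b"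
abbreviation minus_expr (infixl "[-]" 65) where "a [-] b \<equiv> Binop Sub a b"
abbreviation times_expr (infixl "[*]" 70) where "a [*] b \<equiv> Binop Mul a b"
abbreviation div_expr (infixl "[div]" 70) where "a [div] b \<equiv> Binop Div a b"
abbreviation mod_expr (infixl "[mod]" 70) where "a [mod] b \<equiv> Binop Mod a b"
abbreviation less_expr (infix "[<]" 60) where "a [<] b \<equiv> Binop Less a b"
abbreviation equal_expr (infix "[=]" 60) where "a [=] b \<equiv> Binop Equal a b"
abbreviation assign_com (infix "::=" 56) where "i ::= a \<equiv> Assign i a"
abbreviation seq_com (infixr ";;" 53) where "p ;; q \<equiv> Seq p q"

text \<open>
  Registers: 0 \<open>n\<close>; 1 \<open>n + 1\<close>; 2 the radix; 3 address of the current state \<open>(R, s, v)\<close>; 4 \<open>R + 1\<close>;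
  5 \<open>s\<close>; 6 \<open>v\<close>; 7 the current move (and the loop counter of \<open>pow2_prog\<close>); 8 \<open>2 ^ u\<close> for the vertex \<open>u\<close>
  of the move; 9 best value so far; 10 \<open>u\<close>; 11 new value of \<open>s\<close>; 12 value of the current move;
  13 end of the table and start of the output; 14 next free output cell; 15 output cell holding
  the length of the current cycle; 16 number of vertices output.
\<close>

definition pow2_body :: com where
  "pow2_body = 8 ::= Reg 8 [+] Reg 8 ;; 7 ::= Reg 7 [+] Const 1"

definition pow2_prog :: "nat \<Rightarrow> com" where
  "pow2_prog i = (7 ::= Const 0 ;; 8 ::= Const 1) ;; While (Reg 7 [<] Reg i) pow2_body"

definition decode_prog :: com where
  "decode_prog = 4 ::= Reg 3 [div] (Reg 1 [*] Reg 1) ;;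
     5 ::= Reg 3 [div] Reg 1 [mod] Reg 1 ;; 6 ::= Reg 3 [mod] Reg 1"

definition target_prog :: com where
  "target_prog = If (Reg 7 [mod] Const 2)
     (If (Reg 5 [=] Reg 0) (11 ::= Reg 10) (11 ::= Reg 0)) (11 ::= Reg 5)"

text \<open>
  The state \<open>(R, s, v)\<close> is stored at \<open>((R + 1) * N + s) * N + v\<close> with \<open>N = n + 1\<close>. Using \<open>R + 1\<close>
  keeps the table clear of the adjacency matrix, and increasing addresses visit smaller masks
  first, so that one loop over the addresses fills the table.
\<close>

definition target_index :: expr where
  "target_index = ((Reg 4 [-] Reg 8) [*] Reg 1 [+] Reg 11) [*] Reg 1 [+] Reg 10"

text \<open>Products act as conjunctions, sums as disjunctions and \<open>Const 1 [-] b\<close> as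
  negation. All operands are evaluated, so adjacencies are loaded even if \<open>s = n\<close>;
  their values are then immaterial beside the positive summand.\<close>

definition legal_expr :: expr where
  "legal_expr = ((Reg 4 [-] Const 1) [div] Reg 8 [mod] Const 2) [*]
     (((Reg 5 [=] Reg 0) [+] Load (Reg 6 [*] Reg 0 [+] Reg 10)) [*]
      ((Reg 7 [mod] Const 2 [=] Const 0) [+]
       ((Reg 5 [=] Reg 0) [+] Load (Reg 10 [*] Reg 0 [+] Reg 5) [*] (Const 1 [-] (Reg 5 [=] Reg 6)))))"

text \<open>The power \<open>2 ^ u\<close> is kept up to date in constant time: it doubles only
  after an odd move, when \<open>m div 2\<close> increases.\<close>

definition move_body :: com where
  "move_body = 10 ::= Reg 7 [div] Const 2 ;;
     If legal_expr
       (target_prog ;;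
        12 ::= ((Reg 5 [=] Reg 0) [+] Load target_index [div] Reg 2) [*] Reg 2 [+] Reg 7 ;;
        If (Reg 12 [<] Reg 9) (9 ::= Reg 12) Skip)
       Skip ;;
     8 ::= Reg 8 [+] Reg 8 [*] (Reg 7 [mod] Const 2) ;;
     7 ::= Reg 7 [+] Const 1"

definition cell_start :: com where
  "cell_start = decode_prog ;;
     If ((Reg 4 [=] Const 1) [*] (Reg 5 [=] Reg 0)) (9 ::= Const 0) (9 ::= Reg 1 [*] Reg 2) ;;
     7 ::= Const 0 ;; 8 ::= Const 1"

definition cell_end :: com where
  "cell_end = Store (Reg 3) (Reg 9) ;; 3 ::= Reg 3 [+] Const 1"

definition cell_body :: com where
  "cell_body = cell_start ;; While (Reg 7 [<] Reg 0 [+] Reg 0) move_body ;; cell_end"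

text \<open>Register 8 still holds \<open>2 ^ n\<close> from \<open>pow2_prog\<close>. The table
  starts at \<open>N * N\<close>, the block of the empty mask, with
  \<open>N = n + 1\<close>.\<close>

definition setup_prog :: com where
  "setup_prog = 1 ::= Reg 0 [+] Const 1 ;; 2 ::= Reg 1 [+] Reg 1 ;;
     13 ::= (Reg 8 [+] Const 1) [*] (Reg 1 [*] Reg 1) ;; 3 ::= Reg 1 [*] Reg 1"

definition fill_prog :: com where
  "fill_prog = While (Reg 3 [<] Reg 13) cell_body"

definition output_start :: com where
  "output_start = Store (Reg 13) (Load (Reg 13 [-] Const 1) [div] Reg 2) ;;
     3 ::= Reg 13 [-] Const 1 ;; 14 ::= Reg 13 [+] Const 1 ;; 16 ::= Const 0"

definition read_move :: com where
  "read_move = decode_prog ;; 7 ::= Load (Reg 3) [mod] Reg 2 ;;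
     10 ::= Reg 7 [div] Const 2 ;; target_prog"

text \<open>Starting a cycle reserves a cell for its length, which every vertex of the cycle
  increments. This relies on cells behind the table being 0.\<close>

definition write_vertex :: com where
  "write_vertex =
     If (Reg 5 [=] Reg 0) (15 ::= Reg 14 ;; 14 ::= Reg 14 [+] Const 1) Skip ;;
     Store (Reg 14) (Reg 10) ;; 14 ::= Reg 14 [+] Const 1 ;;
     Store (Reg 15) (Load (Reg 15) [+] Const 1) ;;
     3 ::= target_index ;; 16 ::= Reg 16 [+] Const 1"

text \<open>\<open>pow2_prog\<close> overwrites the move in register 7, but by then registers 10 and
  11 hold all that is needed of it.\<close>

definition output_body :: com where
  "output_body = read_move ;; pow2_prog 10 ;; write_vertex"

definition cover_prog :: com where
  "cover_prog = pow2_prog 0 ;; setup_prog ;; fill_prog ;; output_start ;;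
     While (Reg 16 [<] Reg 0) output_body ;; 0 ::= Reg 13"

section \<open>Correctness of the program\<close>

text \<open>\<open>A\<close> is the end of the table. The slack in \<open>B\<close> covers the
  output, at most \<open>2 * n + 1\<close> words, and candidates whose cost exceeds the infinite
  value by one.\<close>

locale cover_ram = cover_dp +
  fixes w B N A :: nat
  assumes N_def: "N = n + 1" and A_def: "A = (2 ^ n + 1) * (N * N)"
    and B_def: "B = A + 4 * N + 4" and B_le: "B \<le> 2 ^ w"
begin

section \<open>Addresses and memory contents of the table\<close>

lemma radix_eq: "radix = N + N"
  by (simp add: radix_def N_def)

lemma N_pos: "0 < N" and n_less_N: "n < N"
  by (simp_all add: N_def)

lemma square_le_A: "2 * (N * N) \<le> A"
proof -
  have "2 * (N * N) \<le> (2 ^ n + 1) * (N * N)" by (intro mult_right_mono) auto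
  then show ?thesis by (simp add: A_def)
qed

lemma exp_less_A: "2 ^ n < A"
proof -
  have "(2 ^ n + 1) * 1 \<le> (2 ^ n + 1) * (N * N)" using N_pos by (intro mult_left_mono) auto
  then show ?thesis by (simp add: A_def)
qed

lemma consts_less [simp]: "0 < B" "Suc 0 < B" "1 < B" "2 < B" "6 < B"
  using N_pos by (auto simp: B_def)

lemma small_less: "x \<le> A + 4 * N \<Longrightarrow> x < B"
  by (simp add: B_def)

definition index :: "nat \<Rightarrow> nat \<Rightarrow> nat \<Rightarrow> nat" where
  "index Y s v = (Y * N + s) * N + v"

lemma index_decode:
  assumes "s < N" "v < N"
  shows "index Y s v div (N * N) = Y" "index Y s v div N mod N = s" "index Y s v mod N = v"
proof -
  have "index Y s v div N = Y * N + s" using assms by (simp add: index_def)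
  moreover have "(Y * N + s) div N = Y" "(Y * N + s) mod N = s" using assms by simp_all
  ultimately show "index Y s v div (N * N) = Y" "index Y s v div N mod N = s"
    by (simp_all add: div_mult2_eq)
  show "index Y s v mod N = v" using assms by (simp add: index_def)
qed

lemma index_less:
  assumes "s < N" "v < N"
  shows "index Y s v < Suc Y * (N * N)"
proof -
  have "index Y s v < Suc (Y * N + s) * N" using assms by (simp add: index_def)
  also have "\<dots> \<le> (Suc Y * N) * N" using assms by (intro mult_right_mono) auto
  finally show ?thesis by (simp only: mult.assoc)
qed

lemma index_ge: "Y * (N * N) \<le> index Y s v"
  by (simp add: index_def algebra_simps)

text \<open>The initial state occupies the last cell of the table, where \<open>output_start\<close>
  looks it up.\<close>

lemma index_last: "index (2 ^ n) n n = A - 1"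
proof -
  have "A = 2 ^ n * (N * N) + N * N" by (simp add: A_def add_mult_distrib)
  moreover have "N * N = n * N + N" by (simp add: N_def)
  moreover have "index (2 ^ n) n n = 2 ^ n * (N * N) + n * N + n"
    by (simp add: index_def add_mult_distrib mult.assoc)
  ultimately show ?thesis using N_def by linarith
qed

definition cell :: "nat \<Rightarrow> nat" where
  "cell a = best (a div (N * N) - 1) (a div N mod N) (a mod N)"

definition table :: "nat \<Rightarrow> nat \<Rightarrow> nat" where
  "table a a' = (if a' < N * N then snd (input_state n G) a' else if a' < a then cell a' else 0)"

lemma table_input: "table (N * N) = snd (input_state n G)"
proof
  fix a
  have "snd (input_state n G) a = 0" if "\<not> a < N * N"
    using that by (auto simp: input_state_def N_def)
  then show "table (N * N) a = snd (input_state n G) a" by (simp add: table_def)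
qed

lemma table_update: "N * N \<le> a \<Longrightarrow> (table a)(a := cell a) = table (Suc a)"
  by (auto simp: table_def fun_eq_iff)

text \<open>The junk row \<open>v = n\<close> is read for the initial state, where the last vertex is undefined.\<close>

lemma table_adj:
  assumes "v \<le> n" "u < n"
  shows "table a (v * n + u) = of_bool ((v, u) \<in> parcs G)"
proof -
  have le: "v * n \<le> n * n" using assms by (intro mult_right_mono) auto
  moreover have "N * N = n * n + 2 * n + 1" by (simp add: N_def)
  ultimately have less: "v * n + u < N * N" using assms by linarith
  show ?thesis
  proof (cases "v = n")
    case True
    then have "(v, u) \<notin> parcs G" using arc_fst_in_verts[of "(v,u)"] verts by auto
    then show ?thesis using less True by (simp add: table_def input_state_def)
  next
    case False
    then have "Suc v * n \<le> n * n" using assms by (intro mult_right_mono) auto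
    then have "v * n + u < n * n" using assms by simp
    moreover have "(v * n + u) div n = v" "(v * n + u) mod n = u" using assms by simp_all
    ultimately show ?thesis using less by (simp add: table_def input_state_def)
  qed
qed

text \<open>For \<open>s = n\<close> the address belongs to the next row or lies just behind the
  matrix; a bound is all that the overflow check needs.\<close>

lemma table_adj_le:
  assumes "s \<le> n" "u < n"
  shows "table a (u * n + s) \<le> 1"
proof -
  have "Suc u * n \<le> n * n" using assms by (intro mult_right_mono) auto
  then have "u * n + s \<le> n * n" using assms by simp
  moreover have "n * n < N * N" by (simp add: N_def)
  ultimately show ?thesis by (simp add: table_def input_state_def)
qed

text \<open>A block with a smaller mask than that of \<open>a\<close> lies entirely below
  \<open>a\<close>, so it is already filled for all \<open>s\<close> and \<open>v\<close>.\<close>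

lemma table_index:
  assumes "s < N" "v < N" "1 \<le> Y" "Y < a div (N * N)"
  shows "table a (index Y s v) = best (Y - 1) s v"
proof -
  have "N * N \<le> Y * (N * N)" using assms by (cases Y) auto
  also have "\<dots> \<le> index Y s v" by (rule index_ge)
  finally have "\<not> index Y s v < N * N" by simp
  moreover have "index Y s v < a"
  proof -
    have "index Y s v < Suc Y * (N * N)" using assms by (intro index_less)
    also have "\<dots> \<le> a div (N * N) * (N * N)" using assms by (intro mult_right_mono) auto
    also have "\<dots> \<le> a" by simp
    finally show ?thesis .
  qed
  ultimately show ?thesis using assms by (simp add: table_def cell_def index_decode)
qed

lemma index_bound:
  assumes "s < N" "v < N" "Y \<le> 2 ^ n"
  shows "index Y s v < A" "Y * N + s < A" "(Y * N + s) * N < A" "Y * N < A"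
proof -
  have "index Y s v < Suc Y * (N * N)" using assms by (intro index_less)
  also have "\<dots> \<le> (2 ^ n + 1) * (N * N)" using assms by (intro mult_right_mono) auto
  finally show *: "index Y s v < A" by (simp only: A_def)
  then show "(Y * N + s) * N < A" by (simp add: index_def)
  moreover have "Y * N + s \<le> (Y * N + s) * N" using N_pos by (cases N) auto
  ultimately show "Y * N + s < A" by linarith
  then show "Y * N < A" by simp
qed

lemma pow2_runs:
  assumes "fst s i \<le> n" "i \<noteq> 7" "i \<noteq> 8"
  shows "runs w ((n + 2) * 20) (pow2_prog i) s
    (\<lambda>s'. s' = ((fst s)(7 := fst s i, 8 := 2 ^ fst s i), snd s))"
proof -
  define j where "j = fst s i"
  define I where "I k s' \<longleftrightarrow> s' = ((fst s)(7 := k, 8 := 2 ^ k), snd s)" for k and s' :: state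
  have j: "j \<le> n" using assms by (simp add: j_def)
  have start: "runs w 5 (7 ::= Const 0 ;; 8 ::= Const 1) s (I 0)"
    by (rule runs_mono[OF runs_wp[where B = B]]) (auto simp: B_le I_def)
  have loop: "runs w ((j + 1) * (1 + 3 + 9)) (While (Reg 7 [<] Reg i) pow2_body) s' (I j)"
    if "I 0 s'" for s'
  proof (rule runs_mono[OF runs_While[where B = B and I = I and T = 9, OF that]])
    fix k s' assume k: "k < j" "I k s'"
    have "k < n" using k j by simp
    then have "(2 :: nat) ^ Suc k \<le> 2 ^ n" by (intro power_increasing) auto
    then have "2 ^ k + 2 ^ k < B" using exp_less_A by (intro small_less) auto
    moreover have "k + 1 < B" using \<open>k < n\<close> by (intro small_less) (auto simp: N_def)
    ultimately show "runs w 9 pow2_body s' (I (Suc k))"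
      using k unfolding I_def pow2_body_def
      by (intro runs_mono[OF runs_wp[where B = B]]) (auto simp: B_le)
  qed (use assms in \<open>auto simp: I_def B_le j_def\<close>)
  have "1 + 5 + (j + 1) * (1 + 3 + 9) \<le> (n + 2) * 20" using j by simp
  with runs_Seq[OF start loop] show ?thesis
    unfolding pow2_prog_def I_def j_def by (rule runs_mono) auto
qed


section \<open>Evaluation of a single move\<close>

lemma bit_iff_div_mod: "bit (R :: nat) u \<longleftrightarrow> R div 2 ^ u mod 2 = 1"
  by (simp add: bit_iff_odd odd_iff_mod_2_eq_one)

lemma target_le: "s \<le> n \<Longrightarrow> m div 2 < n \<Longrightarrow> target s m < N"
  by (simp add: target_def N_def)

definition env :: "state \<Rightarrow> bool" where
  "env st \<longleftrightarrow> fst st 0 = n \<and> fst st 1 = N \<and> fst st 2 = radix \<and> fst st 13 = A"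

definition best_upto :: "nat \<Rightarrow> nat \<Rightarrow> nat \<Rightarrow> nat \<Rightarrow> nat" where
  "best_upto R s v m = Min (insert (init R s) (cand R s ` {m'. legal R s v m' \<and> m' < m}))"

lemma best_upto_0: "best_upto R s v 0 = init R s"
  by (simp add: best_upto_def)

lemma best_upto_Suc:
  "best_upto R s v (Suc m) =
     (if legal R s v m then min (best_upto R s v m) (cand R s m) else best_upto R s v m)"
proof -
  have fin: "finite {m'. legal R s v m' \<and> m' < m}" by simp
  have "{m'. legal R s v m' \<and> m' < Suc m} =
    (if legal R s v m then insert m {m'. legal R s v m' \<and> m' < m} else {m'. legal R s v m' \<and> m' < m})"
    by (auto simp: less_Suc_eq)
  then show ?thesis using fin
    by (auto simp: best_upto_def insert_commute[of "init R s"] min.commute)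
qed

lemma best_upto_final: "best_upto R s v (2 * n) = best R s v"
proof -
  have "{m'. legal R s v m' \<and> m' < 2 * n} = {m'. legal R s v m'}" by (auto dest: legal_less)
  then show ?thesis by (simp add: best_upto_def best_eq)
qed

lemma cost_bound: "cost R s v \<le> N"
proof -
  have "best R s v div radix \<le> (N * radix) div radix"
    using best_le[of R s v] by (intro div_le_mono) (simp add: N_def)
  then show ?thesis by (simp add: cost_def)
qed

lemma fits_timesI:
  "fits B a st \<Longrightarrow> fits B b st \<Longrightarrow> ideal_eval a st * ideal_eval b st < B \<Longrightarrow> fits B (a [*] b) st"
  by simp

lemma fits_plusI:
  "fits B a st \<Longrightarrow> fits B b st \<Longrightarrow> ideal_eval (a [+] b) st < B \<Longrightarrow> fits B (a [+] b) st"
  by simp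

lemma ideal_eval_times: "ideal_eval (a [*] b) st = ideal_eval a st * ideal_eval b st"
  by simp

lemma wp_target_prog:
  assumes "r 0 = n" "r 10 = r 7 div 2" "r 7 < B"
  shows "wp B target_prog Q (r, \<mu>) \<longleftrightarrow> Q (r(11 := target (r 5) (r 7)), \<mu>)"
  using assms by (simp add: target_prog_def target_def odd_iff_mod_2_eq_one)

lemma target_index_eval:
  assumes "r 1 = N" "r 11 < N" "r 10 < N" "r 4 \<le> 2 ^ n"
  shows "fits B target_index (r, \<mu>)"
    "ideal_eval target_index (r, \<mu>) = index (r 4 - r 8) (r 11) (r 10)"
proof -
  have "r 4 - r 8 \<le> 2 ^ n" using assms by simp
  from index_bound[OF assms(2,3) this] show "fits B target_index (r, \<mu>)"
    using assms exp_less_A by (simp add: target_index_def B_def index_def)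
  show "ideal_eval target_index (r, \<mu>) = index (r 4 - r 8) (r 11) (r 10)"
    using assms by (simp add: target_index_def index_def)
qed

lemma legal_expr_eval:
  assumes r: "r 0 = n" "r 4 = Suc R" "r 5 = s" "r 6 = v" "r 7 = m" "r 8 = 2 ^ (m div 2)" "r 10 = m div 2"
    and R: "R < 2 ^ n" and s: "s \<le> n" and v: "v \<le> n" and m: "m < 2 * n"
  shows "fits B legal_expr (r, table a)" "ideal_eval legal_expr (r, table a) \<noteq> 0 \<longleftrightarrow> legal R s v m"
proof -
  let ?x1 = "(Reg 4 [-] Const 1) [div] Reg 8 [mod] Const 2"
  let ?x2 = "(Reg 5 [=] Reg 0) [+] Load (Reg 6 [*] Reg 0 [+] Reg 10)"
  let ?y = "Load (Reg 10 [*] Reg 0 [+] Reg 5) [*] (Const 1 [-] (Reg 5 [=] Reg 6))"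
  let ?s = "(Reg 5 [=] Reg 0) [+] ?y"
  let ?x3 = "(Reg 7 [mod] Const 2 [=] Const 0) [+] ?s"
  define u where "u = m div 2"
  have u: "u < n" using m by (simp add: u_def)
  define x1 where "x1 = R div 2 ^ u mod 2"
  define x2 :: nat where "x2 = of_bool (s = n) + of_bool ((v, u) \<in> parcs G)"
  define y where "y = table a (u * n + s) * (1 - of_bool (s = v))"
  define x3 where "x3 = of_bool (even m) + (of_bool (s = n) + y)"
  have le: "x1 \<le> 1" "x2 \<le> 2" "x3 \<le> 3" "y \<le> 1"
    using table_adj_le[OF s u, of a] by (auto simp: x1_def x2_def x3_def y_def)
  \<comment> \<open>The truth values used are at most 1, 2 and 3, so no product of them exceeds
    6.\<close>
  have prod_le: "x2 * x3 \<le> 6" "x1 * (x2 * x3) \<le> 6"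
    using mult_le_mono[OF le(2,3)] mult_le_mono[OF le(1) mult_le_mono[OF le(2,3)]] by simp_all
  have small: "v * n + u < B" "u * n + s < B" "v * n < B" "u * n < B" "Suc R < B" "m < B"
  proof -
    have "v * n + u \<le> n * n + n" using u v by (intro add_mono mult_right_mono) auto
    moreover have "u * n + s \<le> n * n + n" using u s by (intro add_mono mult_right_mono) auto
    moreover have "n * n + n < B" using square_le_A by (simp add: N_def B_def)
    ultimately show "v * n + u < B" "u * n + s < B" "v * n < B" "u * n < B" by simp_all
    show "Suc R < B" "m < B" using R m exp_less_A by (auto simp: B_def N_def)
  qed
  have e1: "ideal_eval ?x1 (r, table a) = x1" "fits B ?x1 (r, table a)"
    using r small le_less_trans[OF div_le_dividend[of R "2 ^ u"], of B] by (simp_all add: x1_def u_def)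
  have e2: "ideal_eval ?x2 (r, table a) = x2"
    using r u v by (simp add: x2_def table_adj u_def)
  have f2: "fits B ?x2 (r, table a)"
    using e2 le small r by (simp add: u_def) (use consts_less in linarith)
  have ey: "ideal_eval ?y (r, table a) = y"
    using r by (simp add: y_def u_def)
  have fy: "fits B ?y (r, table a)"
    using ey le small r by (simp add: u_def)
  have e3: "ideal_eval ?x3 (r, table a) = x3"
    using r ey by (simp add: x3_def even_iff_mod_2_eq_zero)
  have f3: "fits B ?x3 (r, table a)"
  proof (intro fits_plusI fy)
    have "ideal_eval ?s (r, table a) = of_bool (s = n) + y"
      using r ey by simp
    moreover have "of_bool (s = n) + y \<le> 2" using le(4) by auto
    ultimately show "ideal_eval ?s (r, table a) < B"
      using consts_less(5) by linarith
    show "ideal_eval ?x3 (r, table a) < B"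
      unfolding e3 using le(3) consts_less(5) by linarith
  qed (use small r in auto)
  have eval: "ideal_eval legal_expr (r, table a) = x1 * (x2 * x3)"
    by (simp only: legal_expr_def e1(1) e2 e3 ideal_eval_times)
  show "fits B legal_expr (r, table a)"
    unfolding legal_expr_def
  proof (intro fits_timesI e1(2) f2 f3)
    show "ideal_eval ?x2 (r, table a) * ideal_eval ?x3 (r, table a) < B"
      unfolding e2 e3 using prod_le consts_less by linarith
  qed (use eval prod_le consts_less in \<open>simp only: legal_expr_def ideal_eval_times; linarith\<close>)
  have "x1 = of_bool (bit R u)" by (simp add: x1_def bit_iff_div_mod of_bool_def)
  then show "ideal_eval legal_expr (r, table a) \<noteq> 0 \<longleftrightarrow> legal R s v m"
    unfolding eval using u s table_adj[of u s a]
    by (cases "s = n") (auto simp: legal_def x2_def x3_def y_def u_def[symmetric])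
qed

lemma best_less: "best R s v < B"
proof (rule small_less)
  have "best R s v \<le> N * (N + N)"
    using best_le[of R s v] by (simp only: N_def[symmetric] radix_eq)
  then show "best R s v \<le> A + 4 * N" using square_le_A by (simp add: algebra_simps)
qed

lemma move_body_runs:
  assumes env: "env st" and mem: "snd st = table a"
    and regs: "fst st 3 = a" "fst st 4 = Suc R" "fst st 5 = s" "fst st 6 = v" "fst st 7 = m"
      "fst st 8 = 2 ^ (m div 2)" "fst st 9 = best_upto R s v m"
    and a: "a div (N * N) = Suc R" and R: "R < 2 ^ n" and s: "s \<le> n" and v: "v \<le> n" and m: "m < 2 * n"
  shows "runs w (com_cost move_body) move_body st (\<lambda>st'. env st' \<and> snd st' = table a \<and>
    fst st' 3 = a \<and> fst st' 4 = Suc R \<and> fst st' 5 = s \<and> fst st' 6 = v \<and> fst st' 7 = Suc m \<and>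
    fst st' 8 = 2 ^ (Suc m div 2) \<and> fst st' 9 = best_upto R s v (Suc m))"
proof (rule runs_wp[where B = B])
  define u where "u = m div 2"
  have u: "u < n" using m by (simp add: u_def)
  obtain r \<mu> where st: "st = (r, \<mu>)" by (cases st)
  have r: "r 0 = n" "r (Suc 0) = N" "r 2 = radix" "r 13 = A" "\<mu> = table a" "r 3 = a" "r 4 = Suc R"
      "r 5 = s" "r 6 = v" "r 7 = m" "r 8 = 2 ^ u" "r 9 = best_upto R s v m"
    using env mem regs by (simp_all add: st env_def u_def)
  define t where "t = target s m"
  have t: "t < N" using s u by (simp add: t_def target_le u_def)
  have uN: "u < N" using u by (simp add: N_def)
  have legal: "fits B legal_expr (r(10 := u), table a)"
    "ideal_eval legal_expr (r(10 := u), table a) \<noteq> 0 \<longleftrightarrow> legal R s v m"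
    using r R s v m by (intro legal_expr_eval; simp add: u_def)+
  define c where "c = cost (R - 2 ^ u) t u"
  \<comment> \<open>A legal move strictly decreases the mask, so the entry of its target is already
    in the table.\<close>
  have entry: "table a (index (Suc R - 2 ^ u) t u) = best (R - 2 ^ u) t u" if "legal R s v m"
  proof -
    have "2 ^ u \<le> R" using that by (auto simp: legal_def u_def intro: bit_imp_exp_le)
    moreover from this have "R - 2 ^ u < R"
      by (intro diff_less) (auto intro: less_le_trans[of 0 "2 ^ u"])
    ultimately show ?thesis using t uN a by (subst table_index) (auto simp: Suc_diff_le)
  qed
  have entry_less: "best (R - 2 ^ u) t u < B"
    using best_less .
  have c: "(of_bool (s = n) + c) * radix + m = cand R s m"
    by (simp add: cand_def c_def t_def u_def)
  have small: "(of_bool (s = n) + c) * radix < B" "(of_bool (s = n) + c) * radix + m < B"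
    "of_bool (s = n) + c < B" "m < B" "Suc m < B"
  proof -
    show "Suc m < B" using m by (simp add: B_def N_def)
    have "(of_bool (s = n) + c) * radix \<le> (1 + N) * radix"
      using cost_bound by (intro mult_right_mono add_mono) (auto simp: c_def)
    then show *: "(of_bool (s = n) + c) * radix + m < B"
      using square_le_A m N_def by (simp add: radix_eq B_def algebra_simps)
    then show "(of_bool (s = n) + c) * radix < B" "m < B" by simp_all
    have "of_bool (s = n) + c \<le> (of_bool (s = n) + c) * radix"
      by (simp add: radix_def)
    with * show "of_bool (s = n) + c < B" by linarith
  qed
  have P: "2 ^ u + 2 ^ u * (m mod 2) = (2 :: nat) ^ (Suc m div 2)"
    by (cases "even m") (auto simp: u_def odd_iff_mod_2_eq_one)
  have P_less: "2 ^ (Suc m div 2) < B"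
  proof -
    have "(2 :: nat) ^ (Suc m div 2) \<le> 2 ^ n" using m by (intro power_increasing) auto
    then show ?thesis using exp_less_A unfolding B_def by linarith
  qed
  show "wp B move_body (\<lambda>st'. env st' \<and> snd st' = table a \<and>
    fst st' 3 = a \<and> fst st' 4 = Suc R \<and> fst st' 5 = s \<and> fst st' 6 = v \<and> fst st' 7 = Suc m \<and>
    fst st' 8 = 2 ^ (Suc m div 2) \<and> fst st' 9 = best_upto R s v (Suc m)) st"
  proof (cases "legal R s v m")
    case True
    have ix: "fits B target_index (r(10 := u, 11 := t), table a)"
      "ideal_eval target_index (r(10 := u, 11 := t), table a) = index (Suc R - 2 ^ u) t u"
      using target_index_eval[of "r(10 := u, 11 := t)" "table a"] r R t uN by simp_all
    show ?thesis
      using True legal ix entry[OF True] entry_less small P P_less r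
      by (simp add: move_body_def st u_def[symmetric] wp_target_prog t_def[symmetric] env_def
          best_upto_Suc cost_def[symmetric] c_def[symmetric])
        (use c small in \<open>cases "s = n"; auto simp: min_def\<close>)
  next
    case False
    then show ?thesis using legal small P P_less r
      by (simp add: move_body_def st u_def[symmetric] env_def best_upto_Suc)
  qed
qed (use B_le in auto)

end

section \<open>Filling the table\<close>

lemmas prog_defs = pow2_body_def decode_prog_def target_prog_def target_index_def legal_expr_def
  move_body_def cell_start_def cell_end_def setup_prog_def output_start_def read_move_def write_vertex_def

text \<open>The summands account for computing \<open>2 ^ n\<close>, the straight-line parts, the
  table with linear time per cell, and the output with linear time per vertex. Each 4 is the cost of
  a loop test.\<close>

definition time_bound :: "nat \<Rightarrow> nat" where
  "time_bound n = (n + 2) * 20 + 100 + (2 ^ n * ((n + 1) * (n + 1)) + 1) * (4 + (n + 1) * 1000)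
     + (n + 1) * (4 + (n + 1) * 200)"

context cover_ram
begin

lemma small_values: "N * N < B" "N < B" "A < B" "n + n < B" "N * radix < B" "N + N < B" "2 ^ n + 1 < B"
proof -
  show "N * N < B" "N * radix < B" using square_le_A by (auto simp: B_def radix_eq algebra_simps)
  show "N < B" "A < B" "n + n < B" "N + N < B" by (simp_all add: B_def N_def)
  show "2 ^ n + 1 < B" using exp_less_A by (simp add: B_def)
qed

lemma wp_decode_prog:
  assumes "r 1 = N" "r 3 < B"
  shows "wp B decode_prog Q (r, \<mu>) \<longleftrightarrow>
    Q (r(4 := r 3 div (N * N), 5 := r 3 div N mod N, 6 := r 3 mod N), \<mu>)"
  using assms small_values le_less_trans[OF div_le_dividend[of "r 3" N], of B] by (simp add: decode_prog_def)

lemma init_eq: "init R s = (if R = 0 \<and> s = n then 0 else N * radix)"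
  by (simp add: init_def N_def)

text \<open>Every address of the table decodes to a triple in range, reachable or not, and
  \<open>best\<close> is defined on all of them.\<close>

lemma cell_body_runs:
  assumes env: "env st" and mem: "snd st = table a" and reg: "fst st 3 = a" and a: "N * N \<le> a" "a < A"
  shows "runs w ((n + 1) * 1000) cell_body st
    (\<lambda>st'. env st' \<and> snd st' = table (Suc a) \<and> fst st' 3 = Suc a)"
proof -
  define R s v where "R = a div (N * N) - 1" and "s = a div N mod N" and "v = a mod N"
  define I where "I m st' \<longleftrightarrow> env st' \<and> snd st' = table a \<and> fst st' 3 = a \<and> fst st' 4 = Suc R \<and>
    fst st' 5 = s \<and> fst st' 6 = v \<and> fst st' 7 = m \<and> fst st' 8 = 2 ^ (m div 2) \<and>
    fst st' 9 = best_upto R s v m" for m and st' :: state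
  have NN: "0 < N * N" using N_pos by simp
  have "1 \<le> a div (N * N)" using a NN by (simp add: Suc_le_eq div_greater_zero_iff)
  then have R: "a div (N * N) = Suc R" by (simp add: R_def)
  have "a div (N * N) < 2 ^ n + 1" using a by (intro less_mult_imp_div_less) (simp only: A_def)
  then have R_less: "R < 2 ^ n" using R by simp
  have s: "s \<le> n" and v: "v \<le> n" using N_pos by (simp_all add: s_def v_def N_def less_Suc_eq_le[symmetric])
  have cell: "cell a = best R s v" by (simp add: cell_def R_def s_def v_def)
  have aB: "a < B" "Suc a < B" using a by (simp_all add: B_def)
  obtain r where st: "st = (r, table a)" using mem by (cases st) auto
  have r: "r 0 = n" "r (Suc 0) = N" "r 2 = radix" "r 13 = A" "r 3 = a"
    using env reg by (simp_all add: st env_def)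
  have "wp B cell_start (I 0) st"
    using r aB small_values R
    by (simp add: cell_start_def st wp_decode_prog s_def[symmetric] v_def[symmetric] I_def env_def best_upto_0 init_eq)
  then have start: "runs w (com_cost cell_start) cell_start st (I 0)"
    by (rule runs_wp) (use B_le in auto)
  have loop: "runs w ((2 * n + 1) * (1 + 5 + com_cost move_body))
      (While (Reg 7 [<] Reg 0 [+] Reg 0) move_body) st' (I (2 * n))" if "I 0 st'" for st'
  proof (rule runs_mono[OF runs_While[where B = B and I = I, OF that]])
    show "runs w (com_cost move_body) move_body st'' (I (Suc m))" if "m < 2 * n" "I m st''" for m st''
      unfolding I_def by (rule move_body_runs) (use that R R_less s v in \<open>auto simp: I_def\<close>)
  qed (use B_le small_values in \<open>auto simp: I_def env_def algebra_simps\<close>)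
  have stop: "runs w (com_cost cell_end) cell_end st'
      (\<lambda>st'. env st' \<and> snd st' = table (Suc a) \<and> fst st' 3 = Suc a)" if I: "I (2 * n) st'" for st'
  proof (rule runs_wp)
    show "wp B cell_end (\<lambda>st'. env st' \<and> snd st' = table (Suc a) \<and> fst st' 3 = Suc a) st'"
      using I aB table_update[OF a(1)] by (simp add: cell_end_def I_def env_def best_upto_final cell)
  qed (use B_le in auto)
  have "1 + com_cost cell_start + (1 + (2 * n + 1) * (1 + 5 + com_cost move_body) + com_cost cell_end)
    \<le> (n + 1) * 1000"
    by (simp add: prog_defs)
  with runs_Seq[OF start runs_Seq[OF loop stop]] show ?thesis
    unfolding cell_body_def by (rule runs_mono)
qed

lemma fill_prog_runs:
  assumes "env st" "snd st = table (N * N)" "fst st 3 = N * N"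
  shows "runs w ((2 ^ n * (N * N) + 1) * (4 + (n + 1) * 1000)) fill_prog st
    (\<lambda>st'. env st' \<and> snd st' = table A)"
proof -
  define I where "I k st' \<longleftrightarrow> env st' \<and> snd st' = table (N * N + k) \<and> fst st' 3 = N * N + k"
    for k and st' :: state
  have A: "N * N + 2 ^ n * (N * N) = A" by (simp add: A_def)
  have "runs w ((2 ^ n * (N * N) + 1) * (1 + 3 + (n + 1) * 1000)) fill_prog st (I (2 ^ n * (N * N)))"
    unfolding fill_prog_def
  proof (rule runs_mono[OF runs_While[where B = B and I = I and T = "(n + 1) * 1000"]])
    show "I 0 st" using assms by (simp add: I_def)
    have "I (Suc k) = (\<lambda>st'. env st' \<and> snd st' = table (Suc (N * N + k)) \<and> fst st' 3 = Suc (N * N + k))"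
      for k by (simp add: I_def fun_eq_iff)
    then show "runs w ((n + 1) * 1000) cell_body st' (I (Suc k))"
      if "k < 2 ^ n * (N * N)" "I k st'" for k st'
      using cell_body_runs[of st' "N * N + k"] that A by (simp only: I_def)
  qed (use B_le A in \<open>auto simp: I_def env_def\<close>)
  then show ?thesis by (rule runs_mono) (auto simp: I_def A)
qed

section \<open>Reading an optimal cover off the table\<close>

definition blocks :: "nat list list \<Rightarrow> nat list" where
  "blocks cs = concat (map (\<lambda>c. length c # c) cs)"

lemma encode_cycles_eq: "encode_cycles cs = length cs # blocks cs"
  by (simp add: encode_cycles_def blocks_def)

lemma length_blocks: "length (blocks cs) = length cs + length (concat cs)"
  by (induction cs) (auto simp: blocks_def)

definition written :: "nat list \<Rightarrow> nat \<Rightarrow> nat" where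
  "written xs a = (if a < A then table A a else if a - A < length xs then xs ! (a - A) else 0)"

lemma written_Nil: "written [] = table A"
proof -
  have "N * N \<le> A" using square_le_A by simp
  then show ?thesis by (auto simp: written_def table_def fun_eq_iff)
qed

lemma written_snoc: "written (xs @ [y]) = (written xs)(A + length xs := y)"
  by (auto simp: written_def fun_eq_iff nth_append)

lemma written_update: "written (xs @ d # ys) = (written (xs @ c # ys))(A + length xs := d)"
  by (auto simp: written_def fun_eq_iff nth_append nth_Cons')

lemma written_nth: "i < length xs \<Longrightarrow> written xs (A + i) = xs ! i"
  by (simp add: written_def)

definition opt_size :: nat where "opt_size = cost (2 ^ n - 1) n n"

text \<open>The number of cycles started plus the remaining cost stays equal to the optimum.
  Register 15 is constrained only while a path is open; the 1 in its address skips the word for the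
  number of cycles.\<close>

definition reading :: "nat \<Rightarrow> nat \<Rightarrow> nat \<Rightarrow> nat \<Rightarrow> nat list list \<Rightarrow> state \<Rightarrow> bool" where
  "reading k R s v cs st \<longleftrightarrow> partial_cover R s v cs \<and> length cs + cost R s v = opt_size \<and>
     card (bits R) = n - k \<and> k \<le> n \<and> env st \<and> snd st = written (opt_size # blocks cs) \<and>
     fst st 3 = index (Suc R) s v \<and> fst st 14 = A + 1 + length (blocks cs) \<and>
     (s \<noteq> n \<longrightarrow> fst st 15 = A + 1 + length (blocks (butlast cs))) \<and> fst st 16 = k"

lemma opt_size_le: "opt_size \<le> n"
  unfolding opt_size_def by (rule cost_start_le_n)

lemma bits_less:
  assumes "R < 2 ^ n" "u \<in> bits R"
  shows "u < n"
proof -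
  have "2 ^ u \<le> R" using assms by (intro bit_imp_exp_le) (simp add: bits_def)
  then have "(2 :: nat) ^ u < 2 ^ n" using assms(1) by (rule le_less_trans)
  then show ?thesis by simp
qed

lemma finite_bits: "R < 2 ^ n \<Longrightarrow> finite (bits R)"
  by (rule finite_subset[of _ "{..<n}"]) (auto dest: bits_less)

lemma output_start_runs:
  assumes "env st" "snd st = table A"
  shows "runs w (com_cost output_start) output_start st (reading 0 (2 ^ n - 1) n n [])"
proof (rule runs_wp)
  obtain r where st: "st = (r, table A)" using assms by (cases st) auto
  have r: "r 0 = n" "r (Suc 0) = N" "r 2 = radix" "r 13 = A"
    using assms by (simp_all add: st env_def)
  have "2 ^ n < A div (N * N)" using N_pos by (simp add: A_def)
  then have "table A (A - 1) = best (2 ^ n - 1) n n"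
    using table_index[of n n "2 ^ n" A] by (simp add: index_last n_less_N)
  moreover have "table A A = 0" using square_le_A by (simp add: table_def)
  ultimately show "wp B output_start (reading 0 (2 ^ n - 1) n n []) st"
    using r small_values best_less[of "2 ^ n - 1" n n] partial_cover_start written_Nil written_snoc[of "[]"]
    by (simp add: output_start_def st reading_def env_def opt_size_def cost_def[symmetric] blocks_def
        bits_mask[simplified] index_last B_def)
qed (use B_le in auto)


lemma blocks_snoc: "blocks (cs @ [c]) = blocks cs @ length c # c"
  by (simp add: blocks_def)

lemma output_body_runs:
  assumes reading: "reading k R s v cs st" and k: "k < n"
  shows "runs w ((n + 1) * 200) output_body st (\<lambda>st'. \<exists>R s v cs. reading (Suc k) R s v cs st')"
proof -
  have pc: "partial_cover R s v cs" and total: "length cs + cost R s v = opt_size"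
    and card: "card (bits R) = n - k" and env: "env st" and mem: "snd st = written (opt_size # blocks cs)"
    and regs: "fst st 3 = index (Suc R) s v" "fst st 14 = A + 1 + length (blocks cs)"
      "s \<noteq> n \<longrightarrow> fst st 15 = A + 1 + length (blocks (butlast cs))" "fst st 16 = k"
    using reading by (auto simp: reading_def)
  have R: "R < 2 ^ n" and s: "s \<le> n" and v: "v \<le> n" using pc by (auto simp: partial_cover_def)
  have "R \<noteq> 0" using card k bits_eq_empty_iff[of R] by auto
  moreover have "cost R s v \<le> n" using total opt_size_le by simp
  ultimately obtain m where m: "legal R s v m" "best R s v mod radix = m"
    "cost R s v = of_bool (s = n) + cost (R - 2 ^ (m div 2)) (target s m) (m div 2)"
    using best_step[of R s v] by blast
  define u t cs' R' where "u = m div 2" and "t = target s m" and "cs' = extend s u cs" and "R' = R - 2 ^ u"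
  have u: "u < n" "bit R u" "m < 2 * n" using m(1) legal_less by (auto simp: legal_def u_def)
  have uN: "u < N" "s < N" "v < N" "t < N" using u s v target_le[of s m] by (simp_all add: N_def t_def u_def)
  have pc': "partial_cover R' t u cs'"
    using partial_cover_step[OF pc m(1)] by (simp add: R'_def t_def u_def cs'_def)
  have ext: "s = n \<or> cs \<noteq> []" using pc by (auto simp: partial_cover_def)
  then have total': "length cs' + cost R' t u = opt_size"
    using total m(3) length_extend[of s cs u, OF ext] by (auto simp: cs'_def R'_def t_def u_def)
  have "bits R' = bits R - {u}" using u by (simp add: R'_def bits_minus_exp)
  then have card': "card (bits R') = n - Suc k"
    using card u finite_bits[OF R] by (simp add: bits_def)
  have "2 ^ u \<le> R" using u by (intro bit_imp_exp_le)
  then have R': "Suc R - 2 ^ u = Suc R'" by (simp add: R'_def Suc_diff_le)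
  obtain r where st: "st = (r, written (opt_size # blocks cs))" using mem by (cases st) auto
  define q l where "q = A + 1 + length (blocks cs)" and "l = r 15"
  have r: "r 0 = n" "r (Suc 0) = N" "r 2 = radix" "r 13 = A" "r 3 = index (Suc R) s v" "r 14 = q"
    "r 15 = l" "r 16 = k"
    using env regs by (simp_all add: st env_def q_def l_def)
  have ix: "index (Suc R) s v < A" using index_bound(1)[of s v "Suc R"] uN R by simp
  \<comment> \<open>All states have their cells below \<open>A\<close>, so output written from
    \<open>A\<close> onwards does not disturb them; hence \<open>entry\<close> holds for any
    \<open>xs\<close>.\<close>
  moreover have "Suc R < A div (N * N)" using N_pos R by (simp add: A_def)
  ultimately have entry: "written xs (index (Suc R) s v) = best R s v" for xs
    using table_index[of s v "Suc R" A] uN by (simp add: written_def)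
  have small: "m < B" "index (Suc R) s v < B" "Suc k < B" "u < B"
    using u ix k by (simp_all add: B_def N_def)
  let ?r1 = "r(4 := Suc R, 5 := s, 6 := v, 7 := m, 10 := u, 11 := t)"
  have read: "runs w (com_cost read_move) read_move st (\<lambda>st'. st' = (?r1, written (opt_size # blocks cs)))"
  proof (rule runs_wp)
    show "wp B read_move (\<lambda>st'. st' = (?r1, written (opt_size # blocks cs))) st"
      using r small best_less[of R s v] uN
      by (simp add: read_move_def st wp_decode_prog wp_target_prog entry m(2) index_decode u_def[symmetric]
          t_def[symmetric])
  qed (use B_le in auto)
  let ?r2 = "?r1(7 := u, 8 := 2 ^ u)"
  have pow: "runs w ((n + 2) * 20) (pow2_prog 10) st' (\<lambda>st'. st' = (?r2, written (opt_size # blocks cs)))"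
    if "st' = (?r1, written (opt_size # blocks cs))" for st'
    using pow2_runs[of st' 10] that u by simp
  have lengths: "length cs \<le> n" "length (concat cs) \<le> n"
  proof -
    show "length cs \<le> n" using total opt_size_le by simp
    have "length (concat cs) = card (set (concat cs))"
      using pc distinct_card[of "concat cs"] by (simp add: partial_cover_def)
    also have "\<dots> \<le> card {..<n}" using pc by (intro card_mono) (auto simp: partial_cover_def)
    finally show "length (concat cs) \<le> n" by simp
  qed
  then have q: "Suc (Suc q) < B" by (simp add: q_def B_def N_def length_blocks)
  have writing: "runs w (com_cost write_vertex) write_vertex st' (reading (Suc k) R' t u cs')"
    if st': "st' = (?r2, written (opt_size # blocks cs))" for st'
  proof (rule runs_wp)
    have tix: "fits B target_index (r', \<mu>)" "ideal_eval target_index (r', \<mu>) = index (Suc R') t u"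
      if "r' 1 = N" "r' 11 = t" "r' 10 = u" "r' 4 = Suc R" "r' 8 = 2 ^ u" for r' \<mu>
      using target_index_eval[of r' \<mu>] that uN R R' by simp_all
    show "wp B write_vertex (reading (Suc k) R' t u cs') st'"
    proof (cases "s = n")
      case True
      have cs': "cs' = cs @ [[u]]" by (simp add: cs'_def extend_def True)
      have zero: "written (opt_size # blocks cs) q = 0" by (simp add: written_def q_def)
      \<comment> \<open>The machine writes the vertex first and then raises the reserved cell from 0
        to 1; the list view appends the length before the vertex.\<close>
      have upd: "(written (opt_size # blocks cs))(Suc q := u, q := Suc 0) = written (opt_size # blocks cs')"
        using written_snoc[of "opt_size # blocks cs" 1] written_snoc[of "opt_size # blocks cs @ [1]" u]
        by (simp add: cs' blocks_snoc q_def fun_upd_twist)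
      show ?thesis
        using r small q True pc' total' card' k zero upd tix
        by (simp add: st' write_vertex_def reading_def env_def) (simp add: cs' blocks_snoc q_def)
    next
      case False
      then obtain ds p where cs: "cs = ds @ [p]" using ext by (metis append_butlast_last_id)
      have cs': "cs' = ds @ [p @ [u]]" by (simp add: cs'_def extend_def False cs)
      have l: "l = A + 1 + length (blocks ds)" using regs(3) False by (simp add: l_def st cs)
      have len: "written (opt_size # blocks cs) l = length p" by (simp add: written_def l cs blocks_snoc nth_append)
      \<comment> \<open>The length cell is not the one just written, so its old value
        \<open>length p\<close> is still loaded.\<close>
      have "l < q" by (simp add: l q_def cs blocks_snoc)
      have upd: "(written (opt_size # blocks cs))(q := u, l := Suc (length p)) = written (opt_size # blocks cs')"
        using written_snoc[of "opt_size # blocks cs" u]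
          written_update[of "opt_size # blocks ds" "Suc (length p)" "p @ [u]" "length p"]
        by (simp add: cs' cs blocks_snoc q_def l)
      have "Suc (length p) < B" using lengths by (simp add: cs B_def N_def)
      then show ?thesis
        using r small q False pc' total' card' k len upd tix \<open>l < q\<close>
        by (simp add: st' write_vertex_def reading_def env_def) (simp add: cs' cs blocks_snoc q_def l)
    qed
  qed (use B_le in auto)
  have "1 + com_cost read_move + (1 + (n + 2) * 20 + com_cost write_vertex) \<le> (n + 1) * 200"
    by (simp add: prog_defs)
  with runs_Seq[OF read runs_Seq[OF pow writing]] show ?thesis
    unfolding output_body_def by (rule runs_mono) auto
qed


text \<open>After \<open>n\<close> moves the mask is empty. As the remaining cost is finite, no path
  is open and that cost is 0, so exactly \<open>opt_size\<close> cycles have been built.\<close>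

lemma reading_finished:
  assumes "reading n R s v cs st"
  shows "length cs = opt_size" "distinct cs" "min_cycle_cover G (set cs)"
proof -
  have pc: "partial_cover R s v cs" and total: "length cs + cost R s v = opt_size" and "card (bits R) = 0"
    using assms by (auto simp: reading_def)
  then have R: "R = 0" using finite_bits[of R] by (simp add: partial_cover_def bits_eq_empty_iff)
  have "cost R s v \<le> n" using total opt_size_le by simp
  with R have "s = n" "cost R s v = 0" using cost_finished[of s v] by simp_all
  with total pc R show "length cs = opt_size" "distinct cs" "min_cycle_cover G (set cs)"
    using partial_cover_optimal[of v cs] by (simp_all add: opt_size_def)
qed

lemma cover_prog_runs: "runs w (time_bound n) cover_prog (input_state n G) (outputs_min_cycle_cover G)"
proof -
  obtain r where st: "input_state n G = (r, table (N * N))" and r: "r 0 = n"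
    using table_input by (auto simp: input_state_def)
  have pow: "runs w ((n + 2) * 20) (pow2_prog 0) (input_state n G)
    (\<lambda>st. st = (r(7 := n, 8 := 2 ^ n), table (N * N)))"
    using pow2_runs[of "input_state n G" 0] by (simp add: st r)
  let ?Q = "\<lambda>st. env st \<and> snd st = table (N * N) \<and> fst st 3 = N * N"
  have prepare: "runs w (com_cost setup_prog) setup_prog st ?Q"
    if "st = (r(7 := n, 8 := 2 ^ n), table (N * N))" for st
  proof (rule runs_wp)
    have "Suc n = N" by (simp add: N_def)
    have "Suc (2 ^ n) * (N * N) = A" by (simp add: A_def)
    then show "wp B setup_prog ?Q st"
      using small_values \<open>Suc n = N\<close> by (simp only: that) (simp add: setup_prog_def r env_def radix_eq)
  qed (use B_le in auto)
  have fill: "runs w ((2 ^ n * (N * N) + 1) * (4 + (n + 1) * 1000)) fill_prog st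
    (\<lambda>st'. env st' \<and> snd st' = table A)" if "?Q st" for st
    using fill_prog_runs that by blast
  define I where "I k st \<longleftrightarrow> (\<exists>R s v cs. reading k R s v cs st)" for k and st :: state
  have start: "runs w (com_cost output_start) output_start st (I 0)"
    if "env st \<and> snd st = table A" for st
    using that by (intro runs_mono[OF output_start_runs]) (auto simp: I_def)
  have loop: "runs w ((n + 1) * (4 + (n + 1) * 200)) (While (Reg 16 [<] Reg 0) output_body) st (I n)"
    if "I 0 st" for st
  proof (rule runs_mono[OF runs_While[where B = B and I = I and T = "(n + 1) * 200", OF that]])
    show "runs w ((n + 1) * 200) output_body st (I (Suc k))" if "k < n" "I k st" for k st
      using that output_body_runs unfolding I_def by blast
  qed (use B_le in \<open>auto simp: I_def reading_def env_def\<close>)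
  have finish: "runs w 2 (0 ::= Reg 13) st (outputs_min_cycle_cover G)" if final: "I n st" for st
  proof (rule runs_mono[OF runs_wp])
    obtain R s v cs where *: "reading n R s v cs st" using final by (auto simp: I_def)
    then have "snd st = written (encode_cycles cs)" "fst st 13 = A"
      using reading_finished(1)[OF *] by (simp_all add: reading_def encode_cycles_eq env_def)
    then show "wp B (0 ::= Reg 13) (outputs_min_cycle_cover G) st"
      using reading_finished(2,3)[OF *] written_nth[of _ "encode_cycles cs"]
      unfolding outputs_min_cycle_cover_def by (simp del: fun_upd_apply) (auto intro!: exI[of _ cs])
  qed (use B_le in auto)
  have seq: "runs w (1 + (n + 2) * 20 + (1 + com_cost setup_prog +
      (1 + (2 ^ n * (N * N) + 1) * (4 + (n + 1) * 1000) + (1 + com_cost output_start +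
      (1 + (n + 1) * (4 + (n + 1) * 200) + 2))))) cover_prog (input_state n G) (outputs_min_cycle_cover G)"
    unfolding cover_prog_def
    by (rule runs_Seq[OF pow runs_Seq[OF prepare runs_Seq[OF fill runs_Seq[OF start runs_Seq[OF loop finish]]]]])
  show ?thesis
    by (rule runs_mono[OF seq]) (simp_all add: time_bound_def N_def setup_prog_def output_start_def)
qed

text \<open>The first output word is the length of a distinct list, hence the size of the cover; one
  more load turns the search program into one for the size.\<close>

lemma outputs_min_cycle_cover_length:
  assumes "outputs_min_cycle_cover G st"
  shows "snd st (fst st 0) = min_cycle_cover_size G"
proof -
  from assms obtain cs where cs: "distinct cs" "min_cycle_cover G (set cs)"
    "\<forall>i < length (encode_cycles cs). snd st (fst st 0 + i) = encode_cycles cs ! i"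
    by (auto simp: outputs_min_cycle_cover_def)
  from cs(3) have "snd st (fst st 0) = card (set cs)"
    using cs(1) by (auto simp: encode_cycles_def distinct_card dest: spec[of _ 0])
  also have "\<dots> = min_cycle_cover_size G"
    unfolding min_cycle_cover_size_def
    using cs(2) by (intro Least_equality[symmetric]) (auto simp: min_cycle_cover_def)
  finally show ?thesis .
qed

lemma cover_size_prog_runs:
  "runs w (time_bound n + 10) (cover_prog ;; 0 ::= Load (Reg 0)) (input_state n G) (outputs_min_cycle_cover_size G)"
proof -
  have "runs w 3 (0 ::= Load (Reg 0)) st (outputs_min_cycle_cover_size G)"
    if "outputs_min_cycle_cover G st" for st
    using outputs_min_cycle_cover_length[OF that] B_le
    by (intro runs_mono[OF runs_wp[where B = B]]) (auto simp: outputs_min_cycle_cover_size_def)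
  from runs_Seq[OF cover_prog_runs this] show ?thesis by (rule runs_mono) auto
qed

end

section \<open>Asymptotic running time and word length\<close>

lemma time_bound_bigo: "(\<lambda>n. real (time_bound n + 10)) \<in> O(\<lambda>n. 2 ^ n * real n ^ 3)"
  unfolding time_bound_def of_nat_add of_nat_mult of_nat_power of_nat_numeral of_nat_1
  by real_asymp

lemma word_length_suffices:
  assumes "10 * (n + 1) \<le> w"
  shows "(2 ^ n + 1) * ((n + 1) * (n + 1)) + 4 * (n + 1) + 4 \<le> (2 :: nat) ^ w"
proof -
  define N where "N = n + 1"
  have N: "N \<le> 2 ^ N" by (simp add: less_imp_le)
  have "(2 :: nat) ^ n + 1 \<le> 2 ^ N" by (simp add: N_def)
  then have "(2 ^ n + 1) * (N * N) \<le> (2 ^ N) * (2 ^ N * 2 ^ N)"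
    by (intro mult_le_mono N)
  also have "\<dots> = 2 ^ (3 * N)" by (simp add: power_add[symmetric])
  \<comment> \<open>The exponent \<open>9 * N\<close> is generous enough for the other summand as
    well; their sum is at most \<open>2 ^ Suc (9 * N)\<close>, which \<open>10 * N\<close> bits
    accommodate.\<close>
  also have "\<dots> \<le> 2 ^ (9 * N)" by (intro power_increasing) auto
  finally have 1: "(2 ^ n + 1) * (N * N) \<le> (2 :: nat) ^ (9 * N)" .
  have "4 * N + 4 \<le> 8 * N" by (simp add: N_def)
  also have "\<dots> \<le> 2 ^ 3 * 2 ^ N" using N by simp
  also have "\<dots> = 2 ^ (3 + N)" by (simp add: power_add)
  also have "\<dots> \<le> 2 ^ (9 * N)" by (intro power_increasing) (auto simp: N_def)
  finally have "(2 ^ n + 1) * (N * N) + (4 * N + 4) \<le> 2 * 2 ^ (9 * N)" using 1 by linarith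
  also have "\<dots> = 2 ^ Suc (9 * N)" by simp
  also have "\<dots> \<le> 2 ^ w" using assms by (intro power_increasing) (auto simp: N_def)
  finally show ?thesis by (simp add: N_def)
qed

lemma cover_ramI:
  assumes "pair_graph G" "pverts G = {..<n}" "10 * (n + 1) \<le> w"
  shows "cover_ram G n w ((2 ^ n + 1) * ((n + 1) * (n + 1)) + 4 * (n + 1) + 4) (n + 1)
    ((2 ^ n + 1) * ((n + 1) * (n + 1)))"
  using assms word_length_suffices[OF assms(3)]
  by (intro cover_ram.intro cover_dp.intro cover_dp_axioms.intro cover_ram_axioms.intro) auto

lemma solvable_in_timeI:
  assumes "\<And>n w G B N A. cover_ram G n w B N A \<Longrightarrow>
    runs w (time_bound n + 10) p (input_state n G) (correct G)"
  shows "solvable_in_time correct (\<lambda>n. 2 ^ n * real n ^ 3)"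
proof -
  have "\<exists>t s. exec w p (input_state n G) t s \<and> t \<le> time_bound n + 10 \<and> correct G s"
    if "pair_graph G \<and> pverts G = {..<n} \<and> 10 * (n + 1) \<le> w" for n w and G :: "nat pair_pre_digraph"
    using assms[OF cover_ramI[of G n w]] that by (simp only: runs_def)
  with time_bound_bigo show ?thesis unfolding solvable_in_time_def
    by (intro exI[of _ p] exI[of _ "10 :: nat"] exI[of _ "\<lambda>n. time_bound n + 10"]) blast
qed

theorem theorem3:
  shows "solvable_in_time outputs_min_cycle_cover_size (\<lambda>n. 2 ^ n * real n ^ 3) \<and>
         solvable_in_time outputs_min_cycle_cover (\<lambda>n. 2 ^ n * real n ^ 3)"
proof
  show "solvable_in_time outputs_min_cycle_cover_size (\<lambda>n. 2 ^ n * real n ^ 3)"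
    by (rule solvable_in_timeI, rule cover_ram.cover_size_prog_runs)
  show "solvable_in_time outputs_min_cycle_cover (\<lambda>n. 2 ^ n * real n ^ 3)"
    by (rule solvable_in_timeI, rule runs_mono, rule cover_ram.cover_prog_runs) auto
qed

end
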